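(* Fix a cube $Q_0\subset\mathbb{R}^n$ and let $0\le F\in L^1(Q_0)$. Assume that there are constants $\Theta\ge 1$ and $0\le\delta<2^{-1}$ such that for every $Q\in\mathcal{D}(Q_0)\setminus\{Q_0\}$ there exist non-negative measurable functions $H^Q$, $G^Q$ on $Q$ and a constant $g^Q\ge 0$ satisfying (i) $F(x)\le G^Q(x)+H^Q(x)$ for a.e. $x\in Q$; (ii) $\|H^Q\|_{L^\infty(Q)}\le\Theta\,\frac{1}{|\widehat Q|}\int_{\widehat Q}F\,dx$; (iii) $\frac1{|Q|}\int_Q G^Q\,dx\le\delta\,\frac{1}{|\widehat Q|}\int_{\widehat Q}F\,dx+g^Q$. Define $G^*_{Q_0}(x):=\sup g^Q$, where the supremum is over all $Q\in\mathcal{D}(Q_0)\setminus\{Q_0\}$ with $x\in Q$. Write $F_{Q_0}=\frac1{|Q_0|}\int_{Q_0}F\,dx$. (1) For every $\lambda\ge F_{Q_0}$, $\lambda>0$, every $K>\Theta$ and every $0<\gamma<1$, $$\big|\{x\in Q_0:\mathcal{M}_{Q_0}F(x)>K\lambda,\ G^*_{Q_0}(x)\le\gamma\lambda\}\big|\le\frac{\delta+\gamma}{K-\Theta}\,\big|\{x\in Q_0:\mathcal{M}_{Q_0}F(x)>\lambda\}\big|.$$ (2) Let $1<p<1+\frac{\log(1/(2\delta))}{\log(2\Theta)}$ (if $\delta=0$, any $1<p<\infty$ is allowed). Then there is a constant $C_{p,\Theta,\delta}$ depending only on $p,\Theta,\delta$ such that $$\|F\|_{L^{p,\infty},Q_0}\le\|\mathcal{M}_{Q_0}F\|_{L^{p,\infty},Q_0}\le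 C_{p,\Theta,\delta}\,\|G^*_{Q_0}\|_{L^{p,\infty},Q_0}+C_{p,\Theta,\delta}\,F_{Q_0}$$ and $$\|F\|_{L^{p},Q_0}\le\|\mathcal{M}_{Q_0}F\|_{L^{p},Q_0}\le C_{p,\Theta,\delta}\,\|G^*_{Q_0}\|_{L^{p},Q_0}+C_{p,\Theta,\delta}\,F_{Q_0}.$$
   Context: Cubes in $\mathbb{R}^n$ have sides parallel to the axes and are half-open (so the $2^n$ dyadic children of a cube partition it). $\mathcal{D}(Q_0)$ is the family of dyadic subcubes of $Q_0$ (including $Q_0$), obtained by repeatedly bisecting the sides. For $Q\in\mathcal{D}(Q_0)\setminus\{Q_0\}$, $\widehat Q\in\mathcal{D}(Q_0)$ is the dyadic parent: the unique cube of $\mathcal{D}(Q_0)$ containing $Q$ with side length $2\ell(Q)$. $|E|$ is Lebesgue measure. The local dyadic maximal operator is $\mathcal{M}_{Q_0}f(x)=\sup_{x\in Q\in\mathcal{D}(Q_0)}\frac{1}{|Q|}\int_Q|f|\,dy$ for $x\in Q_0$. Normalized norms: $\|f\|_{L^p,Q}=\big(\frac1{|Q|}\int_Q|f|^p\,dx\big)^{1/p}$ and $\|f\|_{L^{p,\infty},Q}=\sup_{\lambda>0}\lambda\big(|\{x\in Q:|f(x)|>\lambda\}|/|Q|\big)^{1/p}$. Norms may be $+\infty$. The supremum of the empty set of non-negative numbers is $0$. *)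

theory Defs
  imports "HOL-Probability.Essential_Supremum"
begin

text \<open>
  The constant in the theorem must not depend on the dimension, so the dimension has to be
  quantified inside the formula.  Hence the space R^n is the set of extensional functions
  \<^term>\<open>Pi\<^sub>E {..<n} (\<lambda>_. UNIV :: real set)\<close>, with Lebesgue measure obtained as
  the completion of the n-fold product of one-dimensional Lebesgue-Borel measure.
\<close>

definition leb :: "nat \<Rightarrow> (nat \<Rightarrow> real) measure" where
  "leb n = completion (Pi\<^sub>M {..<n} (\<lambda>_. lborel))"

definition cube :: "nat \<Rightarrow> (nat \<Rightarrow> real) \<Rightarrow> real \<Rightarrow> (nat \<Rightarrow> real) set" where
  "cube n a l = Pi\<^sub>E {..<n} (\<lambda>i. {a i ..< a i + l})"

definition is_cube :: "nat \<Rightarrow> (nat \<Rightarrow> real) set \<Rightarrow> bool" where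
  "is_cube n Q \<longleftrightarrow> (\<exists>a l. 0 < l \<and> Q = cube n a l)"

text \<open>The side length is well defined for cubes in dimension at least 1.\<close>

definition side_length :: "nat \<Rightarrow> (nat \<Rightarrow> real) set \<Rightarrow> real" where
  "side_length n Q = (THE l. 0 < l \<and> (\<exists>a. Q = cube n a l))"

text \<open>
  A subset S of the coordinates selects one of the 2^n children: those coordinates in which
  the upper half of the bisected side is taken.
\<close>

inductive_set dyadic :: "nat \<Rightarrow> (nat \<Rightarrow> real) set \<Rightarrow> (nat \<Rightarrow> real) set set"
  for n :: nat and Q0 :: "(nat \<Rightarrow> real) set" where
  root: "Q0 \<in> dyadic n Q0"
| child: "cube n a l \<in> dyadic n Q0 \<Longrightarrow> 0 < l \<Longrightarrow> S \<subseteq> {..<n} \<Longrightarrow>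
    cube n (\<lambda>i. if i \<in> S then a i + l / 2 else a i) (l / 2) \<in> dyadic n Q0"

definition dyadic_parent ::
  "nat \<Rightarrow> (nat \<Rightarrow> real) set \<Rightarrow> (nat \<Rightarrow> real) set \<Rightarrow> (nat \<Rightarrow> real) set" where
  "dyadic_parent n Q0 Q =
    (THE P. P \<in> dyadic n Q0 \<and> Q \<subseteq> P \<and> side_length n P = 2 * side_length n Q)"

definition avg :: "nat \<Rightarrow> (nat \<Rightarrow> real) set \<Rightarrow> ((nat \<Rightarrow> real) \<Rightarrow> ennreal) \<Rightarrow> ennreal" where
  "avg n Q f = (\<integral>\<^sup>+x\<in>Q. f x \<partial>(leb n)) / emeasure (leb n) Q"

definition dyadic_maximal ::
  "nat \<Rightarrow> (nat \<Rightarrow> real) set \<Rightarrow> ((nat \<Rightarrow> real) \<Rightarrow> real) \<Rightarrow> (nat \<Rightarrow> real) \<Rightarrow> ennreal" where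
  "dyadic_maximal n Q0 f x =
    (SUP Q \<in> {Q \<in> dyadic n Q0. x \<in> Q}. avg n Q (\<lambda>y. ennreal \<bar>f y\<bar>))"

text \<open>Real powers with positive exponent on the extended half-line.\<close>

definition epowr :: "ennreal \<Rightarrow> real \<Rightarrow> ennreal" where
  "epowr t p = (if t = \<infinity> then \<infinity> else ennreal (enn2real t powr p))"

text \<open>
  The normalized norms take the absolute value of the function as argument, so that they apply
  to functions with values in the extended half-line.
\<close>

definition Lp_norm ::
  "nat \<Rightarrow> real \<Rightarrow> (nat \<Rightarrow> real) set \<Rightarrow> ((nat \<Rightarrow> real) \<Rightarrow> ennreal) \<Rightarrow> ennreal" where
  "Lp_norm n p Q f = epowr (avg n Q (\<lambda>x. epowr (f x) p)) (1 / p)"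

definition weak_Lp_norm ::
  "nat \<Rightarrow> real \<Rightarrow> (nat \<Rightarrow> real) set \<Rightarrow> ((nat \<Rightarrow> real) \<Rightarrow> ennreal) \<Rightarrow> ennreal" where
  "weak_Lp_norm n p Q f =
    (SUP t \<in> {0<..}. ennreal t *
      epowr (emeasure (leb n) {x \<in> Q. ennreal t < f x} / emeasure (leb n) Q) (1 / p))"

text \<open>
  The supremum in \<^typ>\<open>ennreal\<close> of the empty set is 0.
\<close>

definition g_star ::
  "nat \<Rightarrow> (nat \<Rightarrow> real) set \<Rightarrow> ((nat \<Rightarrow> real) set \<Rightarrow> real) \<Rightarrow> (nat \<Rightarrow> real) \<Rightarrow> ennreal" where
  "g_star n Q0 g x = (SUP Q \<in> {Q \<in> dyadic n Q0 - {Q0}. x \<in> Q}. ennreal (g Q))"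

text \<open>
  The standing hypotheses.  The functions H Q and G Q may take the value infinity; the integral
  of F is taken in \<^typ>\<open>ennreal\<close>, which is harmless as F is integrable and
  non-negative almost everywhere.
\<close>

definition decomposition ::
  "nat \<Rightarrow> (nat \<Rightarrow> real) set \<Rightarrow> real \<Rightarrow> real \<Rightarrow> ((nat \<Rightarrow> real) \<Rightarrow> real) \<Rightarrow>
    ((nat \<Rightarrow> real) set \<Rightarrow> (nat \<Rightarrow> real) \<Rightarrow> ennreal) \<Rightarrow>
    ((nat \<Rightarrow> real) set \<Rightarrow> (nat \<Rightarrow> real) \<Rightarrow> ennreal) \<Rightarrow>
    ((nat \<Rightarrow> real) set \<Rightarrow> real) \<Rightarrow> bool" where
  "decomposition n Q0 \<Theta> \<delta> F H G g \<longleftrightarrow>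
    1 \<le> n \<and> is_cube n Q0 \<and>
    set_integrable (leb n) Q0 F \<and>
    (AE x in leb n. x \<in> Q0 \<longrightarrow> 0 \<le> F x) \<and>
    (\<forall>Q \<in> dyadic n Q0 - {Q0}.
      H Q \<in> borel_measurable (restrict_space (leb n) Q) \<and>
      G Q \<in> borel_measurable (restrict_space (leb n) Q) \<and>
      0 \<le> g Q \<and>
      (AE x in leb n. x \<in> Q \<longrightarrow> ennreal (F x) \<le> G Q x + H Q x) \<and>
      esssup (restrict_space (leb n) Q) (H Q)
        \<le> ennreal \<Theta> * avg n (dyadic_parent n Q0 Q) (\<lambda>x. ennreal (F x)) \<and>
      avg n Q (G Q)
        \<le> ennreal \<delta> * avg n (dyadic_parent n Q0 Q) (\<lambda>x. ennreal (F x)) + ennreal (g Q))"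

end

theory Submission
  imports Defs
begin

text \<open>
  The set where the maximal function exceeds \<open>\<lambda>\<close> is the disjoint union of the maximal dyadic cubes
  with average above \<open>\<lambda>\<close>; the parent of such a cube \<open>Q\<close> has average at most \<open>\<lambda>\<close>.  On \<open>Q\<close>, the part
  \<open>H Q\<close> contributes at most \<open>\<Theta> \<lambda>\<close> to any average, so an average above \<open>K \<lambda>\<close> forces an average of
  \<open>G Q\<close> above \<open>(K - \<Theta>) \<lambda>\<close>, and the dyadic weak type (1,1) bound on \<open>Q\<close> gives the good-\<open>\<lambda>\<close> inequality.

  For the norms take \<open>K = 2 \<Theta>\<close>: the condition on \<open>p\<close> says exactly that
  \<open>K powr p * (\<delta> / \<Theta>) < 1\<close>, which survives replacing \<open>\<delta>\<close> by \<open>\<delta> + \<gamma>\<close> for a small \<open>\<gamma>\<close>.  The inequality is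
  iterated only along the levels \<open>K ^ k * s0\<close>, where it becomes a contraction, so that no norm has to be
  known to be finite beforehand; \<open>s0\<close> decreases to the average of \<open>F\<close> over \<open>Q0\<close> at the end.

  The bound of \<open>F\<close> by its maximal function almost everywhere follows by covering the set where it fails
  by dyadic cubes inside an open set of almost the same measure.
\<close>

section \<open>Nested families of sets\<close>

text \<open>This is \<open>avg\<close> over an arbitrary measure, so that the stopping-time argument
  can be run without coordinates.\<close>

definition mean :: "'a measure \<Rightarrow> 'a set \<Rightarrow> ('a \<Rightarrow> ennreal) \<Rightarrow> ennreal" where
  "mean M Q f = (\<integral>\<^sup>+x\<in>Q. f x \<partial>M) / emeasure M Q"

text \<open>These are the tree properties of dyadic cubes. \<open>finite_above\<close> supplies
  maximal members although the sets may be arbitrarily small; \<open>countable\<close> makes unions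
  measurable and lets measures be summed.\<close>

locale nested_family =
  fixes M :: "'a measure" and D :: "'a set set"
  assumes countable: "countable D"
    and in_sets: "Q \<in> D \<Longrightarrow> Q \<in> sets M"
    and pos: "Q \<in> D \<Longrightarrow> 0 < emeasure M Q"
    and fin: "Q \<in> D \<Longrightarrow> emeasure M Q < \<infinity>"
    and nested: "P \<in> D \<Longrightarrow> Q \<in> D \<Longrightarrow> P \<inter> Q \<noteq> {} \<Longrightarrow> P \<subseteq> Q \<or> Q \<subseteq> P"
    and finite_above: "Q \<in> D \<Longrightarrow> finite {P \<in> D. Q \<subseteq> P}"
begin

section \<open>Maximal members of a subfamily\<close>

definition maximal_sets :: "'a set set \<Rightarrow> 'a set set" where
  "maximal_sets W = {Q \<in> W. \<forall>P\<in>W. Q \<subseteq> P \<longrightarrow> P = Q}"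

lemma maximal_above:
  assumes "W \<subseteq> D" "Q \<in> W"
  obtains P where "P \<in> maximal_sets W" "Q \<subseteq> P"
proof -
  have "finite {P \<in> W. Q \<subseteq> P}"
    by (rule finite_subset[OF _ finite_above[of Q]]) (use assms in auto)
  moreover have "{P \<in> W. Q \<subseteq> P} \<noteq> {}" using assms by auto
  ultimately obtain P where P: "P \<in> {P \<in> W. Q \<subseteq> P}"
    and max: "\<forall>R\<in>{P \<in> W. Q \<subseteq> P}. P \<subseteq> R \<longrightarrow> P = R"
    using finite_has_maximal[of "{P \<in> W. Q \<subseteq> P}"] by metis
  from P have "Q \<subseteq> P" by simp
  have "P \<in> maximal_sets W" using P max unfolding maximal_sets_def by auto
  with \<open>Q \<subseteq> P\<close> show thesis by (rule that[rotated])
qed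

lemma Union_maximal_sets: "W \<subseteq> D \<Longrightarrow> \<Union>(maximal_sets W) = \<Union>W"
proof
  show "\<Union>(maximal_sets W) \<subseteq> \<Union>W" by (auto simp: maximal_sets_def)
  assume "W \<subseteq> D"
  show "\<Union>W \<subseteq> \<Union>(maximal_sets W)"
  proof (rule Union_least)
    fix Q assume "Q \<in> W"
    then obtain P where "P \<in> maximal_sets W" "Q \<subseteq> P" by (rule maximal_above[OF \<open>W \<subseteq> D\<close>])
    then show "Q \<subseteq> \<Union>(maximal_sets W)" by auto
  qed
qed

lemma disjoint_maximal_sets:
  assumes "W \<subseteq> D"
  shows "disjoint_family_on (\<lambda>Q. Q) (maximal_sets W)"
  unfolding disjoint_family_on_def
proof (intro ballI impI, rule ccontr)
  fix P Q assume *: "P \<in> maximal_sets W" "Q \<in> maximal_sets W" "P \<noteq> Q" "P \<inter> Q \<noteq> {}"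
  then have "P \<subseteq> Q \<or> Q \<subseteq> P"
    using nested[of P Q] assms by (auto simp: maximal_sets_def)
  with * show False by (auto simp: maximal_sets_def)
qed

text \<open>\<open>\<Union>W\<close> is the countable disjoint union of the maximal members of
  \<open>W\<close>, so an estimate on those sums up. Densities and scaled measures are inserted for
  \<open>N1\<close> and \<open>N2\<close> to express integrals and constants.\<close>

lemma compare_on_Union:
  assumes W: "W \<subseteq> D" and N: "sets N1 = sets M" "sets N2 = sets M"
    and le: "\<And>Q. Q \<in> maximal_sets W \<Longrightarrow> emeasure N1 Q \<le> emeasure N2 Q"
  shows "emeasure N1 (\<Union>W) \<le> emeasure N2 (\<Union>W)"
proof -
  have sub: "maximal_sets W \<subseteq> D" using W by (auto simp: maximal_sets_def)
  have c: "countable (maximal_sets W)" using countable sub by (rule countable_subset[rotated])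
  have eq: "emeasure N (\<Union>W) = (\<integral>\<^sup>+Q. emeasure N Q \<partial>count_space (maximal_sets W))"
    if "sets N = sets M" for N
  proof -
    have "emeasure N (\<Union>Q\<in>maximal_sets W. Q) = (\<integral>\<^sup>+Q. emeasure N Q \<partial>count_space (maximal_sets W))"
      by (rule emeasure_UN_countable[OF _ c disjoint_maximal_sets[OF W]])
        (use that sub in_sets in auto)
    then show ?thesis using Union_maximal_sets[OF W] by simp
  qed
  show ?thesis unfolding eq[OF N(1)] eq[OF N(2)]
    by (rule nn_integral_mono) (use le in auto)
qed

lemma sets_Union: "W \<subseteq> D \<Longrightarrow> \<Union>W \<in> sets M"
  using countable in_sets by (meson countable_subset sets.countable_Union subset_eq)

section \<open>Means and the weak type (1,1) bound\<close>

lemma mean_le_iff: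
  assumes "Q \<in> D"
  shows "mean M Q f \<le> c \<longleftrightarrow> (\<integral>\<^sup>+x\<in>Q. f x \<partial>M) \<le> c * emeasure M Q"
proof -
  have *: "a / b \<le> c \<longleftrightarrow> a \<le> c * b" if "0 < b" "b < \<infinity>" for a b :: ennreal
  proof
    assume "a / b \<le> c"
    then have "a / b * b \<le> c * b" by (rule mult_right_mono) simp
    moreover have "a / b * b = a"
      using that by (simp add: ennreal_divide_times)
    ultimately show "a \<le> c * b" by simp
  next
    assume "a \<le> c * b"
    then show "a / b \<le> c" using that by (intro divide_le_posI_ennreal) (auto simp: mult.commute)
  qed
  show ?thesis unfolding mean_def using pos[OF assms] fin[OF assms] by (rule *)
qed

lemma less_mean_iff:
  "Q \<in> D \<Longrightarrow> c < mean M Q f \<longleftrightarrow> c * emeasure M Q < (\<integral>\<^sup>+x\<in>Q. f x \<partial>M)"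
  using mean_le_iff[of Q f c] by (simp add: not_le[symmetric])

text \<open>The maximal members of the covering family are disjoint subsets of \<open>Q\<close>, so
  their lower bounds on the integral add up without loss and the constant is 1.\<close>

lemma weak_type_1_1:
  assumes f: "f \<in> borel_measurable M" and Q: "Q \<in> sets M"
    and B: "B \<subseteq> \<Union>{R \<in> D. R \<subseteq> Q \<and> c * emeasure M R \<le> (\<integral>\<^sup>+x\<in>R. f x \<partial>M)}" (is "_ \<subseteq> \<Union>?W")
  shows "c * emeasure M B \<le> (\<integral>\<^sup>+x\<in>Q. f x \<partial>M)"
proof -
  have W: "?W \<subseteq> D" by auto
  have "c * emeasure M B \<le> c * emeasure M (\<Union>?W)"
    by (intro mult_left_mono emeasure_mono B sets_Union[OF W]) simp
  also have "\<dots> = emeasure (scale_measure c M) (\<Union>?W)" by simp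
  also have "\<dots> \<le> emeasure (density M f) (\<Union>?W)"
    by (rule compare_on_Union[OF W])
      (use f in_sets in \<open>auto simp: maximal_sets_def emeasure_density\<close>)
  also have "\<dots> \<le> emeasure (density M f) Q"
    by (rule emeasure_mono) (use Q in auto)
  also have "\<dots> = (\<integral>\<^sup>+x\<in>Q. f x \<partial>M)" using f Q by (simp add: emeasure_density)
  finally show ?thesis .
qed

section \<open>The maximal function and the good-\<lambda> inequality\<close>

definition maximal_fun :: "('a \<Rightarrow> ennreal) \<Rightarrow> 'a \<Rightarrow> ennreal" where
  "maximal_fun f x = (SUP Q \<in> {Q \<in> D. x \<in> Q}. mean M Q f)"

lemma less_maximal_fun_iff:
  "c < maximal_fun f x \<longleftrightarrow> x \<in> \<Union>{Q \<in> D. c < mean M Q f}"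
  by (auto simp: maximal_fun_def less_SUP_iff)

text \<open>Superlevel sets of such a supremum are countable unions of members. The weights
  \<open>c\<close> are arbitrary, so this covers the maximal function as well as
  \<open>g_star\<close>.\<close>

lemma measurable_SUP_family [measurable]:
  fixes c :: "'a set \<Rightarrow> ennreal"
  assumes "D' \<subseteq> D"
  shows "(\<lambda>x. SUP Q \<in> {Q \<in> D'. x \<in> Q}. c Q) \<in> borel_measurable M"
proof (rule borel_measurableI_greater)
  fix t
  have "Q \<subseteq> space M" if "Q \<in> D'" for Q
    using in_sets[of Q, THEN sets.sets_into_space] that assms by auto
  then have "{x \<in> space M. t < (SUP Q \<in> {Q \<in> D'. x \<in> Q}. c Q)} = \<Union>{Q \<in> D'. t < c Q}"
    unfolding less_SUP_iff by fast
  moreover have "\<Union>{Q \<in> D'. t < c Q} \<in> sets M"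
    by (rule sets_Union) (use assms in auto)
  ultimately show "{x \<in> space M. t < (SUP Q \<in> {Q \<in> D'. x \<in> Q}. c Q)} \<in> sets M" by simp
qed

lemma measurable_maximal_fun: "maximal_fun f \<in> borel_measurable M"
  unfolding maximal_fun_def by (rule measurable_SUP_family) simp

text \<open>The set \<open>par Q\<close> enters as a strictly larger member of \<open>D\<close>:
  maximality of a stopping set \<open>Q\<close> bounds the mean over it by \<open>s\<close>. The
  essential bound on \<open>H Q\<close> is already absorbed into \<open>split\<close>.\<close>

lemma good_lambda:
  fixes g :: "'a set \<Rightarrow> real" and s K \<gamma> \<Theta> \<delta> :: real
  assumes Q0: "Q0 \<in> D"
    and sub0: "\<And>Q. Q \<in> D \<Longrightarrow> Q \<subseteq> Q0"
    and f: "f \<in> borel_measurable M"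
    and par: "\<And>Q. Q \<in> D - {Q0} \<Longrightarrow> par Q \<in> D \<and> Q \<subset> par Q"
    and G: "\<And>Q. Q \<in> D - {Q0} \<Longrightarrow> (\<lambda>x. G Q x * indicator Q x) \<in> borel_measurable M"
    and split: "\<And>Q. Q \<in> D - {Q0} \<Longrightarrow>
      AE x in M. x \<in> Q \<longrightarrow> f x \<le> G Q x + ennreal \<Theta> * mean M (par Q) f"
    and mean_G: "\<And>Q. Q \<in> D - {Q0} \<Longrightarrow>
      mean M Q (G Q) \<le> ennreal \<delta> * mean M (par Q) f + ennreal (g Q)"
    and root_s: "mean M Q0 f \<le> ennreal s"
    and const: "0 < s" "1 \<le> \<Theta>" "0 \<le> \<delta>" "\<Theta> < K" "0 < \<gamma>"
  defines "B \<equiv> {x. ennreal (K * s) < maximal_fun f x \<and>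
      (SUP Q \<in> {Q \<in> D - {Q0}. x \<in> Q}. ennreal (g Q)) \<le> ennreal (\<gamma> * s)}"
  shows "emeasure M (B \<inter> Q0)
    \<le> ennreal ((\<delta> + \<gamma>) / (K - \<Theta>)) * emeasure M {x \<in> Q0. ennreal s < maximal_fun f x}"
proof -
  note [measurable] = f measurable_maximal_fun
  have [measurable]: "(\<lambda>x. SUP Q \<in> {Q \<in> D - {Q0}. x \<in> Q}. ennreal (g Q)) \<in> borel_measurable M"
    by (rule measurable_SUP_family) auto
  define W where "W = {Q \<in> D. ennreal s < mean M Q f}"
  have W: "W \<subseteq> D" by (auto simp: W_def)
  define B' where "B' = B \<inter> space M"
  have B' [measurable]: "B' \<in> sets M"
  proof -
    have "B' = {x \<in> space M. ennreal (K * s) < maximal_fun f x \<and>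
      (SUP Q \<in> {Q \<in> D - {Q0}. x \<in> Q}. ennreal (g Q)) \<le> ennreal (\<gamma> * s)}"
      by (auto simp: B'_def B_def)
    also have "\<dots> \<in> sets M" by measurable
    finally show ?thesis .
  qed
  have BW: "B' \<subseteq> \<Union>W"
  proof
    fix x assume "x \<in> B'"
    moreover have "ennreal s \<le> ennreal (K * s)" using const by (intro ennreal_leI) auto
    ultimately have "ennreal s < maximal_fun f x" by (auto simp: B'_def B_def)
    then show "x \<in> \<Union>W" by (simp add: less_maximal_fun_iff W_def)
  qed
  define \<theta> where "\<theta> = ennreal ((\<delta> + \<gamma>) / (K - \<Theta>))"
  have in_space: "Q \<subseteq> space M" if "Q \<in> D" for Q
    using that in_sets sets.sets_into_space by auto
  \<comment> \<open>It suffices to estimate \<open>B'\<close> on each maximal set above level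
    \<open>s\<close>; these sets are disjoint and cover \<open>B'\<close>.\<close>
  have cube: "emeasure M (B' \<inter> Q) \<le> \<theta> * emeasure M Q" if Q: "Q \<in> maximal_sets W" for Q
  proof (cases "B' \<inter> Q = {}")
    case False
    have Q_D: "Q \<in> D" and Q_s: "ennreal s < mean M Q f"
      and Q_max: "\<And>P. P \<in> D \<Longrightarrow> ennreal s < mean M P f \<Longrightarrow> Q \<subseteq> P \<Longrightarrow> P = Q"
      using Q by (auto simp: maximal_sets_def W_def)
    \<comment> \<open>The mean over the root is at most \<open>s\<close>, so a stopping set always
      has a parent.\<close>
    then have "Q \<noteq> Q0" using root_s by auto
    with Q_D have Q': "Q \<in> D - {Q0}" by simp
    have Q_sets [measurable]: "Q \<in> sets M" using Q_D by (rule in_sets)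
    define P where "P = par Q"
    have "P \<in> D" "Q \<subset> P" using par[OF Q'] by (auto simp: P_def)
    then have P_s: "mean M P f \<le> ennreal s" using Q_max[of P] by (auto simp: not_less[symmetric])
    \<comment> \<open>One point of \<open>B'\<close> in \<open>Q\<close> is enough, since the
      supremum at that point dominates \<open>g Q\<close>.\<close>
    have gQ: "ennreal (g Q) \<le> ennreal (\<gamma> * s)"
    proof -
      obtain x where x: "x \<in> B'" "x \<in> Q" using False by auto
      have "ennreal (g Q) \<le> (SUP Q \<in> {Q \<in> D - {Q0}. x \<in> Q}. ennreal (g Q))"
        by (rule SUP_upper) (use Q' x in auto)
      also have "\<dots> \<le> ennreal (\<gamma> * s)" using x by (auto simp: B'_def B_def)
      finally show ?thesis .
    qed
    define G' where "G' x = G Q x * indicator Q x" for x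
    have [measurable]: "G' \<in> borel_measurable M"
      unfolding G'_def using G[OF Q'] .
    define c where "c = ennreal ((K - \<Theta>) * s)"
    have AE_f: "AE x in M. x \<in> Q \<longrightarrow> f x \<le> G' x + ennreal (\<Theta> * s)"
      using split[OF Q']
    proof eventually_elim
      case (elim x)
      have "ennreal \<Theta> * mean M P f \<le> ennreal (\<Theta> * s)"
        using P_s const by (simp add: ennreal_mult mult_left_mono)
      then have "G Q x + ennreal \<Theta> * mean M P f \<le> G Q x + ennreal (\<Theta> * s)"
        by (rule add_left_mono)
      from order_trans[OF _ this] elim show ?case by (simp add: G'_def P_def del: ennreal_add_left_cancel_le)
    qed
    have "B' \<inter> Q \<subseteq> \<Union>{R \<in> D. R \<subseteq> Q \<and> c * emeasure M R \<le> (\<integral>\<^sup>+x\<in>R. G' x \<partial>M)}"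
    proof
      fix x assume x: "x \<in> B' \<inter> Q"
      then have "ennreal (K * s) < maximal_fun f x" by (auto simp: B'_def B_def)
      then obtain R where R: "R \<in> D" "x \<in> R" "ennreal (K * s) < mean M R f"
        by (auto simp: less_maximal_fun_iff)
      have [measurable]: "R \<in> sets M" using R(1) by (rule in_sets)
      \<comment> \<open>As \<open>1 \<le> \<Theta> < K\<close>, the set \<open>R\<close> also has
        mean above \<open>s\<close>; by maximality of \<open>Q\<close> it cannot be strictly larger
        than \<open>Q\<close>.\<close>
      have "ennreal s \<le> ennreal (K * s)" using const by (intro ennreal_leI) auto
      with R have "ennreal s < mean M R f" by simp
      moreover have "R \<subseteq> Q \<or> Q \<subseteq> R" using nested[OF R(1) Q_D] R(2) x by auto
      ultimately have RQ: "R \<subseteq> Q" using Q_max[OF R(1)] by auto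
      \<comment> \<open>The height \<open>K * s\<close> is split as
        \<open>(K - \<Theta>) * s + \<Theta> * s\<close>; the second part is finite on
        \<open>R\<close> and can be cancelled, which leaves a lower bound for the integral of
        \<open>G'\<close>.\<close>
      have "c * emeasure M R + ennreal (\<Theta> * s) * emeasure M R = ennreal (K * s) * emeasure M R"
        using const
        by (simp add: c_def distrib_right[symmetric] ennreal_plus[symmetric] del: ennreal_plus)
      also have "\<dots> \<le> (\<integral>\<^sup>+x\<in>R. f x \<partial>M)" using R(3) by (simp add: less_mean_iff[OF R(1)])
      also have "\<dots> \<le> (\<integral>\<^sup>+x\<in>R. (G' x + ennreal (\<Theta> * s)) \<partial>M)"
        using AE_f by (intro nn_integral_mono_AE, eventually_elim) (use RQ in \<open>auto split: split_indicator\<close>)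
      also have "\<dots> = (\<integral>\<^sup>+x\<in>R. G' x \<partial>M) + ennreal (\<Theta> * s) * emeasure M R"
        by (simp add: distrib_right nn_integral_add nn_integral_cmult)
      finally have "ennreal (\<Theta> * s) * emeasure M R + c * emeasure M R
          \<le> ennreal (\<Theta> * s) * emeasure M R + (\<integral>\<^sup>+x\<in>R. G' x \<partial>M)"
        by (simp only: add.commute)
      moreover have "ennreal (\<Theta> * s) * emeasure M R \<noteq> \<infinity>"
        using fin[OF R(1)] by (simp add: ennreal_mult_eq_top_iff)
      ultimately have "c * emeasure M R \<le> (\<integral>\<^sup>+x\<in>R. G' x \<partial>M)"
        unfolding ennreal_add_left_cancel_le by simp
      with R RQ show "x \<in> \<Union>{R \<in> D. R \<subseteq> Q \<and> c * emeasure M R \<le> (\<integral>\<^sup>+x\<in>R. G' x \<partial>M)}"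
        by blast
    qed
    then have "c * emeasure M (B' \<inter> Q) \<le> (\<integral>\<^sup>+x\<in>Q. G' x \<partial>M)"
      by (rule weak_type_1_1[rotated 2]) auto
    also have "\<dots> = (\<integral>\<^sup>+x\<in>Q. G Q x \<partial>M)"
      by (rule nn_integral_cong) (auto simp: G'_def split: split_indicator)
    also have "\<dots> \<le> (ennreal \<delta> * mean M P f + ennreal (g Q)) * emeasure M Q"
      using mean_G[OF Q'] mean_le_iff[OF Q_D] by (simp add: P_def)
    also have "\<dots> \<le> (ennreal \<delta> * ennreal s + ennreal (\<gamma> * s)) * emeasure M Q"
      by (intro mult_right_mono add_mono mult_left_mono P_s gQ) auto
    also have "\<dots> = ennreal (\<delta> + \<gamma>) * ennreal s * emeasure M Q"
      using const ennreal_mult[of \<gamma> s] ennreal_plus[of \<delta> \<gamma>]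
      by (simp only: distrib_right less_imp_le)
    finally have "ennreal (1 / ((K - \<Theta>) * s)) * (c * emeasure M (B' \<inter> Q))
        \<le> ennreal (1 / ((K - \<Theta>) * s)) * (ennreal (\<delta> + \<gamma>) * ennreal s * emeasure M Q)"
      by (intro mult_left_mono) auto
    moreover have "ennreal (1 / ((K - \<Theta>) * s)) * c = 1"
      using const by (simp add: c_def ennreal_mult[symmetric])
    moreover have "ennreal (1 / ((K - \<Theta>) * s)) * (ennreal (\<delta> + \<gamma>) * ennreal s) = \<theta>"
      using const by (simp add: \<theta>_def ennreal_mult[symmetric] del: ennreal_plus)
    ultimately show ?thesis by (simp add: mult.assoc[symmetric])
  qed simp
  have "emeasure M (B \<inter> Q0) \<le> emeasure M B'"
    by (rule emeasure_mono[OF _ B']) (use in_space[OF Q0] in \<open>auto simp: B'_def\<close>)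
  \<comment> \<open>The measure of \<open>B'\<close> is written as a density, to be compared with
    \<open>\<theta>\<close> times \<open>M\<close> on the disjoint stopping sets.\<close>
  also have "\<dots> = emeasure (density M (indicator B')) (\<Union>W)"
    using BW sets_Union[OF W] B' by (simp add: emeasure_restricted inf_absorb1)
  also have "\<dots> \<le> emeasure (scale_measure \<theta> M) (\<Union>W)"
  proof (rule compare_on_Union[OF W])
    fix Q assume Q: "Q \<in> maximal_sets W"
    then have "Q \<in> sets M" using in_sets by (auto simp: maximal_sets_def W_def)
    with cube[OF Q] show "emeasure (density M (indicator B')) Q \<le> emeasure (scale_measure \<theta> M) Q"
      using B' by (simp add: emeasure_restricted)
  qed auto
  also have "\<dots> = \<theta> * emeasure M (\<Union>W)" by simp
  also have "\<Union>W = {x \<in> Q0. ennreal s < maximal_fun f x}"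
    using sub0 by (auto simp: W_def less_maximal_fun_iff)
  finally show ?thesis by (simp add: \<theta>_def)
qed

end

section \<open>Powers on the extended half-line\<close>

lemma epowr_ennreal: "0 \<le> r \<Longrightarrow> epowr (ennreal r) p = ennreal (r powr p)"
  by (simp add: epowr_def)

lemma epowr_top [simp]: "epowr \<infinity> p = \<infinity>" "epowr top p = top"
  by (simp_all add: epowr_def)

lemma epowr_mono: "0 \<le> p \<Longrightarrow> a \<le> b \<Longrightarrow> epowr a p \<le> epowr b p"
  by (cases a; cases b) (auto simp: epowr_ennreal top_unique intro!: ennreal_leI powr_mono2)

text \<open>The convention \<open>0 powr p = 0\<close> for every \<open>p\<close> agrees with
  \<open>top * 0 = 0\<close>, so multiplicativity survives the mixed case.\<close>

lemma epowr_mult: "epowr (a * b) p = epowr a p * epowr b p"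
proof -
  have top: "epowr (top * b) p = top * epowr b p" for b
  proof (cases b)
    case (real r)
    then show ?thesis
      by (cases "r = 0") (auto simp: epowr_ennreal ennreal_top_mult epowr_def)
  qed (simp add: epowr_def)
  show ?thesis
  proof (cases a)
    case a: (real r)
    show ?thesis
    proof (cases b)
      case b: (real s)
      with a show ?thesis by (simp add: ennreal_mult[symmetric] epowr_ennreal powr_mult)
    qed (use top[of a] in \<open>simp add: mult.commute\<close>)
  qed (simp add: top)
qed

lemma epowr_epowr: "0 < p \<Longrightarrow> epowr (epowr a p) (1 / p) = a"
  by (cases a) (auto simp: epowr_ennreal powr_powr)

text \<open>Follows from \<open>a + b \<le> 2 * max a b\<close>; for \<open>q \<le> 1\<close> the
  factor \<open>2 powr q\<close> is at most 2.\<close>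

lemma epowr_add_le:
  assumes "0 < q" "q \<le> 1"
  shows "epowr (a + b) q \<le> 2 * (epowr a q + epowr b q)"
proof -
  have "epowr (a + b) q \<le> epowr (2 * max a b) q"
    using assms add_mono[OF max.cobounded1[of a b] max.cobounded2[of b a]]
    by (intro epowr_mono) (auto simp: mult_2)
  also have "\<dots> = ennreal (2 powr q) * epowr (max a b) q"
    by (simp add: epowr_mult epowr_ennreal flip: ennreal_numeral)
  also have "\<dots> \<le> 2 * (epowr a q + epowr b q)"
  proof (rule mult_mono)
    have "2 powr q \<le> (2::real) powr 1" using assms by (intro powr_mono) auto
    then show "ennreal (2 powr q) \<le> 2" by (simp add: ennreal_leI flip: ennreal_numeral)
  qed (auto simp: max_def)
  finally show ?thesis .
qed

lemma measurable_epowr [measurable]: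
  assumes [measurable]: "f \<in> borel_measurable M"
  shows "(\<lambda>x. epowr (f x) p) \<in> borel_measurable M"
  unfolding epowr_def by measurable

text \<open>The bound is the fixed point of \<open>x = X + \<eta> * x\<close> and is preserved by
  the recursion. Subtracting \<open>\<eta> * x\<close> instead would require finite values, which
  are not known in advance for the norms in question.\<close>

lemma ennreal_contraction_bound:
  fixes x :: "nat \<Rightarrow> ennreal" and \<eta> :: real
  assumes \<eta>: "0 \<le> \<eta>" "\<eta> < 1" and "x 0 \<le> X" and step: "\<And>n. x (Suc n) \<le> X + ennreal \<eta> * x n"
  shows "x n \<le> ennreal (1 / (1 - \<eta>)) * X"
proof (induction n)
  case 0
  have "1 \<le> ennreal (1 / (1 - \<eta>))" using \<eta> by (simp add: divide_simps flip: ennreal_1)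
  from mult_right_mono[OF this, of X] \<open>x 0 \<le> X\<close> show ?case by (auto intro: order_trans)
next
  case (Suc n)
  have "x (Suc n) \<le> X + ennreal \<eta> * (ennreal (1 / (1 - \<eta>)) * X)"
    using step[of n] Suc by (meson add_left_mono mult_left_mono order_trans zero_le)
  also have "\<dots> = (ennreal 1 + ennreal (\<eta> * (1 / (1 - \<eta>)))) * X"
    using \<eta> by (subst ennreal_mult) (auto simp: distrib_right mult.assoc)
  also have "ennreal 1 + ennreal (\<eta> * (1 / (1 - \<eta>))) = ennreal (1 + \<eta> * (1 / (1 - \<eta>)))"
    using \<eta> by (subst ennreal_plus[symmetric]) auto
  also have "1 + \<eta> * (1 / (1 - \<eta>)) = 1 / (1 - \<eta>)" using \<eta> by (simp add: field_simps)
  finally show ?case .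
qed

text \<open>\<open>Suc k\<close> is the least exponent whose level reaches \<open>v\<close>; that
  exponent is not 0 because \<open>s < v\<close>.\<close>

lemma between_powers:
  fixes K s v :: real
  assumes "1 < K" "0 < s" "s < v"
  obtains k :: nat where "K ^ k * s < v" "v \<le> K ^ Suc k * s"
proof -
  obtain n where "v / s < K ^ n" using real_arch_pow[OF assms(1)] by blast
  then have n: "v \<le> K ^ n * s" using assms by (simp add: field_simps)
  define m where "m = (LEAST n. v \<le> K ^ n * s)"
  have m: "v \<le> K ^ m * s" unfolding m_def using n by (rule LeastI)
  then have "m \<noteq> 0" using assms by (intro notI) simp
  then obtain k where k: "m = Suc k" by (cases m) auto
  have "\<not> v \<le> K ^ k * s" by (rule not_less_Least) (use k m_def in auto)
  with m k show thesis by (intro that[of k]) auto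
qed

text \<open>For \<open>r \<ge> 2\<close> the powers before \<open>r ^ N\<close> sum to at most
  \<open>r ^ N\<close>, so a sum ending with a power below \<open>Y\<close> is at most twice that
  power.\<close>

lemma sum_powers_below:
  fixes r Y :: real
  assumes "2 \<le> r" "0 \<le> Y"
  shows "(\<Sum>k<N. if r ^ k < Y then r ^ k else 0) \<le> 2 * Y"
proof (induction N)
  case (Suc N)
  have geo: "(\<Sum>k<N. r ^ k) \<le> r ^ N" for N
  proof (induction N)
    case (Suc N)
    then have "(\<Sum>k<Suc N. r ^ k) \<le> 2 * r ^ N" by simp
    also have "\<dots> \<le> r * r ^ N" using assms by (intro mult_right_mono) auto
    finally show ?case by simp
  qed simp
  show ?case
  proof (cases "r ^ N < Y")
    case True
    have "(\<Sum>k<N. if r ^ k < Y then r ^ k else 0) \<le> (\<Sum>k<N. r ^ k)"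
      by (intro sum_mono) (use assms in auto)
    with geo[of N] True show ?thesis by simp
  qed (use Suc in simp)
qed (use assms in simp)

text \<open>The leading 1 accounts for values up to the starting level, the first
  \<open>K powr p\<close> for one step between levels, the fraction for a contraction with ratio
  \<open>K powr p * \<theta>\<close>, and the 2 for the sum of powers below a bound.\<close>

definition good_const :: "real \<Rightarrow> real \<Rightarrow> real \<Rightarrow> real \<Rightarrow> real" where
  "good_const K \<theta> \<gamma> p =
    1 + K powr p * (1 / (1 - K powr p * \<theta>)) * (1 + 2 * K powr p * \<gamma> powr (- p))"

definition norm_const :: "real \<Rightarrow> real \<Rightarrow> real \<Rightarrow> real \<Rightarrow> real" where
  "norm_const K \<theta> \<gamma> p = 2 * good_const K \<theta> \<gamma> p powr (1 / p)"

lemma good_const_pos: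
  assumes "K powr p * \<theta> < 1"
  shows "0 < good_const K \<theta> \<gamma> p"
proof -
  have "0 \<le> K powr p * (1 / (1 - K powr p * \<theta>)) * (1 + 2 * K powr p * \<gamma> powr (- p))"
    using assms by (intro mult_nonneg_nonneg add_nonneg_nonneg) auto
  then show ?thesis unfolding good_const_def by linarith
qed

lemma norm_const_pos: "K powr p * \<theta> < 1 \<Longrightarrow> 0 < norm_const K \<theta> \<gamma> p"
  using good_const_pos[of K p \<theta> \<gamma>] by (simp add: norm_const_def)

section \<open>From a good-\<open>\<lambda>\<close> inequality to norms\<close>

text \<open>\<open>U\<close> is later the normalised measure on the root cube. The hypothesis
  \<open>good\<close> starts at \<open>s0\<close>, because the inequality for the maximal function
  is available only from the root average upwards.\<close>

context
  fixes U :: "'a measure" and f G :: "'a \<Rightarrow> ennreal" and K \<theta> \<gamma> p s0 :: real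
  assumes f[measurable]: "f \<in> borel_measurable U" and G[measurable]: "G \<in> borel_measurable U"
    and one: "emeasure U (space U) \<le> 1"
    and const: "2 \<le> K" "0 \<le> \<theta>" "0 < \<gamma>" "1 \<le> p" "K powr p * \<theta> < 1" "0 < s0"
    and good: "\<And>s. s0 \<le> s \<Longrightarrow> emeasure U {x \<in> space U. ennreal (K * s) < f x}
      \<le> ennreal \<theta> * emeasure U {x \<in> space U. ennreal s < f x}
        + emeasure U {x \<in> space U. ennreal (\<gamma> * s) < G x}"
begin

private abbreviation "A \<equiv> good_const K \<theta> \<gamma> p"
private abbreviation "r \<equiv> K powr p"
private abbreviation "c \<equiv> 1 / (1 - r * \<theta>)"
private abbreviation "level k \<equiv> K ^ k * s0"
private abbreviation "a k \<equiv> ennreal (r ^ k) * emeasure U {x \<in> space U. ennreal (level k) < f x}"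
text \<open>By \<open>powr_level\<close> the weight \<open>r ^ k\<close> is
  \<open>level k powr p\<close> up to the factor \<open>s0 powr p\<close>. Hence the supremum of the
  \<open>a k\<close> controls the weak norm of \<open>f\<close> and their sum the strong norm;
  \<open>b k\<close> plays the same part for \<open>G\<close>.\<close>

private abbreviation "b k \<equiv> ennreal (r ^ k) * emeasure U {x \<in> space U. ennreal (\<gamma> * level k) < G x}"

private lemma r_ge: "2 \<le> r"
proof -
  have "2 powr 1 \<le> (2::real) powr p" using const by (intro powr_mono) auto
  also have "\<dots> \<le> K powr p" using const by (intro powr_mono2) auto
  finally show ?thesis by simp
qed

private lemma c_ge: "1 \<le> c"
  using const by (simp add: divide_simps)

private lemma powr_level: "level k powr p = r ^ k * s0 powr p"
proof -
  have "(K ^ k) powr p = r ^ k"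
  proof -
    have "(K ^ k) powr p = (K powr real k) powr p" using const by (simp add: powr_realpow)
    also have "\<dots> = (K powr p) powr real k" by (simp add: powr_powr mult.commute)
    also have "\<dots> = r ^ k" using const by (simp add: powr_realpow)
    finally show ?thesis .
  qed
  then show ?thesis using const by (simp add: powr_mult)
qed

private lemma powr_\<gamma>_level: "(\<gamma> * level k) powr p = r ^ k * (\<gamma> * s0) powr p"
proof -
  have "(\<gamma> * level k) powr p = \<gamma> powr p * level k powr p" by (rule powr_mult)
  also have "\<dots> = r ^ k * (\<gamma> * s0) powr p"
    using const unfolding powr_level by (simp add: powr_mult)
  finally show ?thesis .
qed

private lemma level_ge: "s0 \<le> level k"
  using const by (simp add: one_le_power)

private lemma a_0: "a 0 \<le> 1"
  using order_trans[OF emeasure_space one] by simp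

text \<open>This is \<open>good\<close> at \<open>level k\<close>, multiplied by
  \<open>r ^ Suc k\<close>; the coefficient \<open>r * \<theta> < 1\<close> makes it a
  contraction.\<close>

private lemma a_Suc: "a (Suc k) \<le> ennreal r * b k + ennreal (r * \<theta>) * a k"
proof -
  have "a (Suc k) \<le> ennreal (r ^ Suc k) * (ennreal \<theta> * emeasure U {x \<in> space U. ennreal (level k) < f x}
      + emeasure U {x \<in> space U. ennreal (\<gamma> * level k) < G x})"
    using good[OF level_ge[of k]] by (intro mult_left_mono) (auto simp: mult.assoc)
  also have "\<dots> = ennreal r * b k + ennreal (r * \<theta>) * a k"
    using const r_ge by (simp add: ennreal_mult distrib_left mult_ac)
  finally show ?thesis .
qed

text \<open>Common last step of the weak and the strong estimate. The power \<open>s0 powr p\<close>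
  cancels against \<open>(\<gamma> * s0) powr (- p)\<close>, so \<open>A\<close> is free of
  \<open>s0\<close>, which varies later.\<close>

private lemma weak_aux: "ennreal (s0 powr p) + ennreal r * (ennreal (s0 powr p) * (ennreal c *
    (1 + ennreal r * (ennreal (2 * (\<gamma> * s0) powr (- p)) * X))))
    \<le> ennreal A * (ennreal (s0 powr p) + X)" (is "?L \<le> _")
proof -
  define \<sigma> m where "\<sigma> = s0 powr p" and "m = \<gamma> powr (- p)"
  have pos: "0 < \<sigma>" "0 < m" "0 < r" "0 < c"
    using const c_ge by (auto simp: \<sigma>_def m_def)
  have m: "(\<gamma> * s0) powr (- p) = m / \<sigma>"
    using const by (simp add: powr_mult \<sigma>_def m_def powr_minus divide_inverse)
  have "?L = (ennreal \<sigma> + ennreal r * (ennreal \<sigma> * ennreal c))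
      + (ennreal r * (ennreal \<sigma> * (ennreal c * (ennreal r * ennreal (2 * (m / \<sigma>)))))) * X"
    unfolding m \<sigma>_def[symmetric] by (simp only: distrib_left mult_1_right add.assoc mult.assoc)
  also have "\<dots> = ennreal (\<sigma> + r * (\<sigma> * c)) + ennreal (r * (\<sigma> * (c * (r * (2 * (m / \<sigma>)))))) * X"
    using pos by (simp add: ennreal_mult[symmetric] ennreal_plus[symmetric] del: ennreal_plus)
  also have "\<dots> \<le> ennreal (A * \<sigma>) + ennreal A * X"
  proof (intro add_mono mult_right_mono ennreal_leI)
    define c' where "c' = c"
    have "0 \<le> \<sigma> * (r * (c' * (r * m)))" using pos unfolding c'_def by (intro mult_nonneg_nonneg) auto
    then have "\<sigma> + r * (\<sigma> * c') \<le> (1 + r * c' * (1 + 2 * r * m)) * \<sigma>"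
      by (simp add: algebra_simps)
    then show "\<sigma> + r * (\<sigma> * c) \<le> A * \<sigma>"
      by (simp only: good_const_def m_def c'_def)
    have "r * (\<sigma> * (c * (r * (2 * (m / \<sigma>))))) = r * c * (2 * r * m)"
      using pos by simp
    also have "\<dots> \<le> A"
      using pos by (simp add: good_const_def m_def[symmetric] distrib_left)
    finally show "r * (\<sigma> * (c * (r * (2 * (m / \<sigma>))))) \<le> A" .
  qed simp
  also have "\<dots> = ennreal A * (ennreal \<sigma> + X)"
    using pos by (simp add: distrib_left ennreal_mult'')
  finally show ?thesis by (simp add: \<sigma>_def)
qed

text \<open>\<open>B\<close> stands for the p-th power of the weak norm of \<open>G\<close>. The
  contraction is applied to the single terms \<open>a k\<close>.\<close>

lemma good_lambda_weak:
  assumes B: "\<And>t. 0 < t \<Longrightarrow> ennreal (t powr p) * emeasure U {x \<in> space U. ennreal t < G x} \<le> B"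
    and t: "0 < t"
  shows "ennreal (t powr p) * emeasure U {x \<in> space U. ennreal t < f x}
    \<le> ennreal A * (ennreal (s0 powr p) + B)"
proof -
  let ?B = "ennreal (2 * (\<gamma> * s0) powr (- p)) * B"
  have b: "b k \<le> ?B" for k
  proof -
    have "r ^ k = (\<gamma> * s0) powr (- p) * (\<gamma> * level k) powr p"
      unfolding powr_\<gamma>_level using const by (simp add: powr_minus field_simps)
    then have "b k = ennreal ((\<gamma> * s0) powr (- p)) * (ennreal ((\<gamma> * level k) powr p) *
        emeasure U {x \<in> space U. ennreal (\<gamma> * level k) < G x})"
      by (simp add: ennreal_mult mult.assoc)
    \<comment> \<open>The factor 2 in \<open>?B\<close> is slack here; it is kept so that
      \<open>weak_aux\<close> serves both estimates.\<close>
    also have "\<dots> \<le> ?B"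
      using const by (intro mult_mono B ennreal_leI) auto
    finally show ?thesis .
  qed
  have a: "a k \<le> ennreal c * (1 + ennreal r * ?B)" for k
  proof (rule ennreal_contraction_bound)
    show "a 0 \<le> 1 + ennreal r * ?B" using a_0 by (rule add_increasing2[rotated]) simp
    fix n
    have "ennreal r * b n \<le> 1 + ennreal r * ?B"
      by (intro add_increasing mult_left_mono b) auto
    then show "a (Suc n) \<le> 1 + ennreal r * ?B + ennreal (r * \<theta>) * a n"
      using a_Suc[of n] by (meson add_right_mono order_trans)
  qed (use const in auto)
  have "ennreal (t powr p) * emeasure U {x \<in> space U. ennreal t < f x}
    \<le> ennreal (s0 powr p) + ennreal r * (ennreal (s0 powr p) * (ennreal c * (1 + ennreal r * ?B)))"
  proof (cases "t \<le> s0")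
    case True
    have "ennreal (t powr p) * emeasure U {x \<in> space U. ennreal t < f x} \<le> ennreal (s0 powr p) * 1"
      using True t const order_trans[OF emeasure_space one]
      by (intro mult_mono ennreal_leI powr_mono2) auto
    then show ?thesis by (auto intro: add_increasing2)
  next
    case False
    with const between_powers[of K s0 t] obtain k where k: "level k < t" "t \<le> level (Suc k)"
      by auto
    have "t powr p \<le> r * s0 powr p * r ^ k"
      using powr_mono2[of p t "level (Suc k)"] t k const powr_level[of "Suc k"] by (simp add: mult_ac)
    then have "ennreal (t powr p) * emeasure U {x \<in> space U. ennreal t < f x}
      \<le> ennreal (r * s0 powr p * r ^ k) * emeasure U {x \<in> space U. ennreal (level k) < f x}"
      using k by (intro mult_mono emeasure_mono ennreal_leI)
        (auto intro: le_less_trans[rotated] simp: ennreal_leI)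
    also have "\<dots> = ennreal r * (ennreal (s0 powr p) * a k)"
      by (simp add: ennreal_mult mult_ac)
    also have "\<dots> \<le> ennreal r * (ennreal (s0 powr p) * (ennreal c * (1 + ennreal r * ?B)))"
      by (intro mult_left_mono a) auto
    finally show ?thesis by (rule add_increasing[rotated]) simp
  qed
  also note weak_aux
  finally show ?thesis .
qed

text \<open>The contraction is applied to the partial sums of the \<open>a k\<close>, so the
  integral may be infinite a priori.\<close>

lemma good_lambda_strong:
  "(\<integral>\<^sup>+x. epowr (f x) p \<partial>U) \<le> ennreal A * (ennreal (s0 powr p) + (\<integral>\<^sup>+x. epowr (G x) p \<partial>U))"
  (is "_ \<le> _ * (_ + ?I)")
proof -
  let ?B = "ennreal (2 * (\<gamma> * s0) powr (- p)) * ?I"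
  let ?F = "\<lambda>k x. ennreal (r ^ k) * indicator {x \<in> space U. ennreal (level k) < f x} x"
  let ?H = "\<lambda>k x. ennreal (r ^ k) * indicator {x \<in> space U. ennreal (\<gamma> * level k) < G x} x"
  \<comment> \<open>At a point where \<open>G x = v\<close> is finite, the levels with
    \<open>\<gamma> * level k < v\<close> carry weights that are powers of \<open>r\<close> below a
    multiple of \<open>v powr p\<close>, and these sum geometrically.\<close>
  have sum_b: "(\<Sum>k<N. b k) \<le> ?B" for N
  proof -
    have "(\<Sum>k<N. b k) = (\<integral>\<^sup>+x. (\<Sum>k<N. ?H k x) \<partial>U)"
      by (subst nn_integral_sum) (simp_all add: nn_integral_cmult_indicator)
    also have "\<dots> \<le> (\<integral>\<^sup>+x. ennreal (2 * (\<gamma> * s0) powr (- p)) * epowr (G x) p \<partial>U)"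
    proof (rule nn_integral_mono)
      fix x assume x: "x \<in> space U"
      show "(\<Sum>k<N. ?H k x) \<le> ennreal (2 * (\<gamma> * s0) powr (- p)) * epowr (G x) p"
      proof (cases "G x")
        case (real v)
        let ?Y = "(\<gamma> * s0) powr (- p) * v powr p"
        have lv: "?H k x \<le> ennreal (if r ^ k < ?Y then r ^ k else 0)" for k
        proof (cases "\<gamma> * level k < v")
          case True
          then have "(\<gamma> * level k) powr p < v powr p"
            using const by (intro powr_less_mono2) auto
          then have "r ^ k < ?Y"
            unfolding powr_\<gamma>_level using const by (simp add: powr_minus field_simps)
          then show ?thesis by (auto split: split_indicator)
        qed (use real const in \<open>auto split: split_indicator simp: ennreal_less_iff\<close>)
        have "(\<Sum>k<N. ?H k x) \<le> (\<Sum>k<N. ennreal (if r ^ k < ?Y then r ^ k else 0))"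
          by (rule sum_mono) (rule lv)
        also have "\<dots> = ennreal (\<Sum>k<N. if r ^ k < ?Y then r ^ k else 0)"
          by (rule sum_ennreal) auto
        also have "\<dots> \<le> ennreal (2 * ?Y)"
          by (intro ennreal_leI sum_powers_below r_ge) auto
        finally show ?thesis using real by (simp add: epowr_ennreal ennreal_mult mult.assoc)
      qed (use const in \<open>simp add: ennreal_mult_top\<close>)
    qed
    also have "\<dots> = ?B" by (rule nn_integral_cmult) simp
    finally show ?thesis .
  qed
  have sum_a: "(\<Sum>k<N. a k) \<le> ennreal c * (1 + ennreal r * ?B)" for N
  proof (rule ennreal_contraction_bound[where x = "\<lambda>N. \<Sum>k<N. a k"])
    fix n
    \<comment> \<open>Splitting off the term at 0 and shifting the index turns the recursion for
      \<open>a k\<close> into one for the partial sums.\<close>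
    have "(\<Sum>k<Suc n. a k) = a 0 + (\<Sum>k<n. a (Suc k))" by (rule sum.lessThan_Suc_shift)
    also have "\<dots> \<le> 1 + (\<Sum>k<n. ennreal r * b k + ennreal (r * \<theta>) * a k)"
      by (intro add_mono sum_mono a_0 a_Suc)
    also have "\<dots> = 1 + ennreal r * (\<Sum>k<n. b k) + ennreal (r * \<theta>) * (\<Sum>k<n. a k)"
      by (simp add: sum.distrib sum_distrib_left add.assoc)
    also have "\<dots> \<le> 1 + ennreal r * ?B + ennreal (r * \<theta>) * (\<Sum>k<n. a k)"
      by (intro add_mono mult_left_mono sum_b) auto
    finally show "(\<Sum>k<Suc n. a k) \<le> 1 + ennreal r * ?B + ennreal (r * \<theta>) * (\<Sum>k<n. a k)" .
  qed (use const in auto)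
  have term_le: "g k \<le> suminf g" for g :: "nat \<Rightarrow> ennreal" and k
    using sum_le_suminf[of g "{k}"] by simp
  have pointwise: "epowr (f x) p \<le> ennreal (s0 powr p) +
      ennreal r * (ennreal (s0 powr p) * (\<Sum>k. ?F k x))" (is "_ \<le> ?R") if x: "x \<in> space U" for x
  proof -
    \<comment> \<open>Above \<open>s0\<close> the term of the last level below \<open>v\<close>
      alone dominates. The claim is made for every real \<open>v\<close> up to \<open>f x\<close>,
      so that \<open>f x = top\<close> follows from arbitrarily large \<open>v\<close>.\<close>
    have R: "ennreal (v powr p) \<le> ?R" if v: "0 \<le> v" "ennreal v \<le> f x" for v
    proof (cases "v \<le> s0")
      case True
      then have "ennreal (v powr p) \<le> ennreal (s0 powr p)"
        using v const by (intro ennreal_leI powr_mono2) auto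
      then show ?thesis by (rule add_increasing2[rotated]) simp
    next
      case False
      with const between_powers[of K s0 v] obtain k where k: "level k < v" "v \<le> level (Suc k)"
        by auto
      have "v powr p \<le> r * s0 powr p * r ^ k"
        using powr_mono2[of p v "level (Suc k)"] v k const powr_level[of "Suc k"] by (simp add: mult_ac)
      then have *: "ennreal (v powr p) \<le> ennreal r * (ennreal (s0 powr p) * ennreal (r ^ k))"
        by (simp add: ennreal_mult[symmetric] mult_ac ennreal_leI)
      have "ennreal (level k) < ennreal v"
        using k False const by (intro ennreal_lessI) auto
      then have "ennreal (r ^ k) = ?F k x" using v x by (auto split: split_indicator)
      also have "?F k x \<le> (\<Sum>k. ?F k x)" by (rule term_le)
      finally have "ennreal (v powr p) \<le> ennreal r * (ennreal (s0 powr p) * (\<Sum>k. ?F k x))"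
        by (intro order_trans[OF *] mult_left_mono) auto
      then show ?thesis by (rule add_increasing[rotated]) simp
    qed
    show ?thesis
    proof (cases "f x")
      case (real v)
      then show ?thesis using R[of v] by (simp add: epowr_ennreal)
    next
      case top
      have "?R = top"
      proof (rule ccontr)
        assume "?R \<noteq> top"
        then obtain y where y: "0 \<le> y" "?R = ennreal y" by (cases ?R) auto
        \<comment> \<open>The witness has p-th power \<open>y + 1\<close>, which exceeds the
          supposed finite value \<open>y\<close>.\<close>
        have "ennreal (((y + 1) powr (1 / p)) powr p) \<le> ?R"
          using top by (intro R) auto
        then show False using y const by (simp add: powr_powr)
      qed
      then show ?thesis by simp
    qed
  qed
  have "(\<integral>\<^sup>+x. epowr (f x) p \<partial>U) \<le> (\<integral>\<^sup>+x. (ennreal (s0 powr p) +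
      ennreal r * (ennreal (s0 powr p) * (\<Sum>k. ?F k x))) \<partial>U)"
    by (intro nn_integral_mono pointwise)
  also have "\<dots> = ennreal (s0 powr p) * emeasure U (space U) +
      ennreal r * (ennreal (s0 powr p) * (\<Sum>k. a k))"
    by (simp add: nn_integral_add nn_integral_cmult nn_integral_suminf nn_integral_cmult_indicator)
  also have "\<dots> \<le> ennreal (s0 powr p) * 1 +
      ennreal r * (ennreal (s0 powr p) * (ennreal c * (1 + ennreal r * ?B)))"
    by (intro add_mono mult_left_mono one suminf_le_const summableI sum_a) auto
  also have "\<dots> \<le> ennreal A * (ennreal (s0 powr p) + ?I)"
    using weak_aux by simp
  finally show ?thesis .
qed

private lemma root_bound:
  assumes "X \<le> ennreal A * (ennreal (s0 powr p) + Y)"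
  shows "epowr X (1 / p) \<le> ennreal (norm_const K \<theta> \<gamma> p) * (ennreal s0 + epowr Y (1 / p))"
proof -
  have A: "0 < A" by (rule good_const_pos) (use const in simp)
  have "epowr X (1 / p) \<le> epowr (ennreal A * (ennreal (s0 powr p) + Y)) (1 / p)"
    using assms const by (intro epowr_mono) auto
  also have "\<dots> = ennreal (A powr (1 / p)) * epowr (ennreal (s0 powr p) + Y) (1 / p)"
    using A by (simp add: epowr_mult epowr_ennreal)
  also have "\<dots> \<le> ennreal (A powr (1 / p)) *
      (2 * (epowr (ennreal (s0 powr p)) (1 / p) + epowr Y (1 / p)))"
    using const by (intro mult_left_mono epowr_add_le) auto
  also have "epowr (ennreal (s0 powr p)) (1 / p) = ennreal s0"
    using const by (simp add: epowr_ennreal powr_powr)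
  also have "ennreal (A powr (1 / p)) * (2 * (ennreal s0 + epowr Y (1 / p)))
      = ennreal (norm_const K \<theta> \<gamma> p) * (ennreal s0 + epowr Y (1 / p))"
    by (simp add: norm_const_def ennreal_mult mult.left_commute distrib_left mult.assoc)
  finally show ?thesis .
qed

lemma good_lambda_weak_norm:
  "(SUP t\<in>{0<..}. ennreal t * epowr (emeasure U {x \<in> space U. ennreal t < f x}) (1 / p))
    \<le> ennreal (norm_const K \<theta> \<gamma> p) * (ennreal s0 +
      (SUP t\<in>{0<..}. ennreal t * epowr (emeasure U {x \<in> space U. ennreal t < G x}) (1 / p)))"
  (is "_ \<le> _ * (_ + ?W)")
proof (rule SUP_least)
  fix t :: real assume t: "t \<in> {0<..}"
  \<comment> \<open>Raising to the power \<open>p\<close> turns the quantity in the weak norm into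
    the one bounded by \<open>good_lambda_weak\<close>, with \<open>epowr ?W p\<close> in the place
    of \<open>B\<close>.\<close>
  have power: "epowr (ennreal t * epowr m (1 / p)) p = ennreal (t powr p) * m"
    if "0 < t" for t m
    using that const epowr_epowr[of "1 / p" m] by (simp add: epowr_mult epowr_ennreal)
  have "ennreal (t powr p) * emeasure U {x \<in> space U. ennreal t < G x} \<le> epowr ?W p"
    if "0 < t" for t
    unfolding power[OF that, symmetric]
    by (rule epowr_mono) (use const that in \<open>auto intro: SUP_upper\<close>)
  from root_bound[OF good_lambda_weak[OF this]] t
  have "epowr (ennreal (t powr p) * emeasure U {x \<in> space U. ennreal t < f x}) (1 / p)
      \<le> ennreal (norm_const K \<theta> \<gamma> p) * (ennreal s0 + epowr (epowr ?W p) (1 / p))" by simp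
  then show "ennreal t * epowr (emeasure U {x \<in> space U. ennreal t < f x}) (1 / p)
      \<le> ennreal (norm_const K \<theta> \<gamma> p) * (ennreal s0 + ?W)"
    using t const by (simp add: epowr_mult epowr_epowr epowr_ennreal powr_powr)
qed

lemma good_lambda_strong_norm:
  "epowr (\<integral>\<^sup>+x. epowr (f x) p \<partial>U) (1 / p)
    \<le> ennreal (norm_const K \<theta> \<gamma> p) * (ennreal s0 + epowr (\<integral>\<^sup>+x. epowr (G x) p \<partial>U) (1 / p))"
  using good_lambda_strong by (rule root_bound)

end

section \<open>Dyadic cubes\<close>

text \<open>In dimension 0 all cubes coincide, so corner and side are determined only when
  \<open>1 \<le> n\<close>.\<close>

lemma cube_eq_iff:
  assumes "1 \<le> n" "0 < l" "0 < l'"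
  shows "cube n a l = cube n a' l' \<longleftrightarrow> l = l' \<and> (\<forall>i<n. a i = a' i)"
proof -
  have "cube n a l = cube n a' l' \<longleftrightarrow> (\<forall>i<n. {a i..<a i + l} = {a' i..<a' i + l'})"
    unfolding cube_def using PiE_eq_iff_not_empty[of "{..<n}" "\<lambda>i. {a i..<a i + l}" "\<lambda>i. {a' i..<a' i + l'}"]
      assms by (simp add: Ball_def)
  also have "\<dots> \<longleftrightarrow> (\<forall>i<n. a i = a' i \<and> l = l')"
    using assms by (auto simp: Ico_eq_Ico)
  finally show ?thesis using assms by (auto simp: Suc_le_eq)
qed

lemma side_length_cube:
  assumes "1 \<le> n" "0 < l"
  shows "side_length n (cube n a l) = l"
  unfolding side_length_def using assms by (intro the_equality) (auto simp: cube_eq_iff)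

lemma sets_cube: "cube n a l \<in> sets (Pi\<^sub>M {..<n} (\<lambda>_. lborel))"
  unfolding cube_def by (intro sets_PiM_I_finite) auto

lemma emeasure_cube:
  assumes "0 \<le> l"
  shows "emeasure (leb n) (cube n a l) = ennreal (l ^ n)"
proof -
  interpret product_sigma_finite "\<lambda>_::nat. lborel :: real measure" ..
  have "emeasure (leb n) (cube n a l) = emeasure (Pi\<^sub>M {..<n} (\<lambda>_. lborel)) (cube n a l)"
    by (simp add: leb_def sets_cube)
  also have "\<dots> = ennreal (l ^ n)"
    unfolding cube_def using assms by (subst emeasure_PiM) (auto simp: ennreal_power)
  finally show ?thesis .
qed

section \<open>Grid cells of each generation\<close>

locale root_cube =
  fixes n :: nat and a :: "nat \<Rightarrow> real" and l :: real
  assumes n: "1 \<le> n" and l: "0 < l"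
begin

abbreviation "Q0 \<equiv> cube n a l"

definition idx :: "nat \<Rightarrow> (nat \<Rightarrow> real) \<Rightarrow> nat \<Rightarrow> int" where
  "idx k x i = \<lfloor>(x i - a i) / l * 2 ^ k\<rfloor>"

text \<open>A cube of generation \<open>k\<close> is encoded by any of its points, as the set of
  points with the same grid index. Equality and inclusion of cubes thereby become statements about
  integers.\<close>

definition cell :: "nat \<Rightarrow> (nat \<Rightarrow> real) \<Rightarrow> (nat \<Rightarrow> real) set" where
  "cell k x = {y \<in> Q0. \<forall>i<n. idx k y i = idx k x i}"

lemma cell_cong: "y \<in> cell k x \<Longrightarrow> cell k y = cell k x"
  by (auto simp: cell_def)

lemma cell_self: "x \<in> Q0 \<Longrightarrow> x \<in> cell k x"
  by (auto simp: cell_def)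

lemma cell_subset_root: "cell k x \<subseteq> Q0"
  by (auto simp: cell_def)

text \<open>Passing to a coarser generation drops binary digits: the index is divided by
  \<open>2 ^ (k - j)\<close> and rounded down.\<close>

lemma idx_coarsen:
  assumes "j \<le> k" "idx k x i = idx k y i"
  shows "idx j x i = idx j y i"
proof -
  have "idx j z i = idx k z i div 2 ^ (k - j)" for z
  proof -
    have "idx k z i div 2 ^ (k - j) = \<lfloor>((z i - a i) / l * 2 ^ k) / real_of_int (2 ^ (k - j))\<rfloor>"
      unfolding idx_def by (rule floor_divide_real_eq_div[symmetric]) simp
    also have "((z i - a i) / l * 2 ^ k) / real_of_int (2 ^ (k - j)) = (z i - a i) / l * 2 ^ j"
    proof -
      obtain d where d: "k = j + d" using assms(1) by (auto simp: le_iff_add)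
      show ?thesis unfolding d by (simp add: power_add)
    qed
    finally show ?thesis by (simp add: idx_def)
  qed
  then show ?thesis using assms(2) by simp
qed

lemma cell_antimono: "j \<le> k \<Longrightarrow> cell k x \<subseteq> cell j x"
  unfolding cell_def by (blast intro: idx_coarsen)

lemma idx_bounds:
  assumes "x \<in> Q0" "i < n"
  shows "0 \<le> idx k x i" "idx k x i < 2 ^ k"
proof -
  have x: "a i \<le> x i" "x i < a i + l" using assms by (auto simp: cube_def PiE_iff)
  then show "0 \<le> idx k x i" using l by (simp add: idx_def)
  have "(x i - a i) / l * 2 ^ k < 1 * 2 ^ k"
    using x l by (intro mult_strict_right_mono) auto
  then show "idx k x i < 2 ^ k" by (simp add: idx_def floor_less_iff)
qed

lemma idx_eq_iff: "idx k y i = z \<longleftrightarrow> a i + z * (l / 2 ^ k) \<le> y i \<and> y i < a i + z * (l / 2 ^ k) + l / 2 ^ k"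
  using l by (simp add: idx_def floor_eq_iff field_simps)

lemma cell_eq_cube:
  assumes z: "\<And>i. i < n \<Longrightarrow> z i = idx k x i" and x: "x \<in> Q0"
  shows "cell k x = cube n (\<lambda>i. a i + z i * (l / 2 ^ k)) (l / 2 ^ k)"
proof -
  have "y \<in> cell k x \<longleftrightarrow> y \<in> cube n (\<lambda>i. a i + z i * (l / 2 ^ k)) (l / 2 ^ k)" for y
  proof -
    \<comment> \<open>An index from 0 to \<open>2 ^ k - 1\<close> already places the coordinate in
      the side of \<open>Q0\<close>, so only extensionality remains of
      \<open>y \<in> Q0\<close>.\<close>
    have *: "y i \<in> {a i..<a i + l}" if "i < n" "idx k y i = idx k x i" for i
    proof -
      note b = idx_bounds[OF x that(1), of k]
      define u where "u = (y i - a i) / l"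
      have "0 \<le> u * 2 ^ k"
        using b(1) unfolding that(2)[symmetric] by (simp add: idx_def u_def)
      then have "0 \<le> u" using mult_neg_pos[of u "2 ^ k"] by (cases "u < 0") auto
      have "u * 2 ^ k < 1 * 2 ^ k"
        using b(2) unfolding that(2)[symmetric] by (simp add: idx_def floor_less_iff u_def)
      then have "u < 1" by (rule mult_right_less_imp_less) simp
      with \<open>0 \<le> u\<close> show ?thesis using l by (simp add: u_def zero_le_divide_iff)
    qed
    have "y \<in> cell k x \<longleftrightarrow> y \<in> extensional {..<n} \<and> (\<forall>i<n. idx k y i = idx k x i)"
    proof
      assume "y \<in> extensional {..<n} \<and> (\<forall>i<n. idx k y i = idx k x i)"
      with * show "y \<in> cell k x" unfolding cell_def cube_def PiE_iff by simp
    qed (simp add: cell_def cube_def PiE_iff)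
    also have "\<dots> \<longleftrightarrow> y \<in> extensional {..<n} \<and> (\<forall>i<n. idx k y i = z i)"
      using z by (metis (full_types))
    also have "\<dots> \<longleftrightarrow> y \<in> cube n (\<lambda>i. a i + z i * (l / 2 ^ k)) (l / 2 ^ k)"
      unfolding idx_eq_iff by (auto simp: cube_def PiE_iff)
    finally show ?thesis .
  qed
  then show ?thesis by (rule set_eqI)
qed

lemma cell_zero: "x \<in> Q0 \<Longrightarrow> cell 0 x = Q0"
proof -
  have "idx 0 y i = 0" if "y \<in> Q0" "i < n" for y i
    using idx_bounds[OF that, of 0] by simp
  then show "x \<in> Q0 \<Longrightarrow> cell 0 x = Q0" by (auto simp: cell_def)
qed

definition corner :: "nat \<Rightarrow> (nat \<Rightarrow> real) \<Rightarrow> nat \<Rightarrow> real" where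
  "corner k x i = a i + idx k x i * (l / 2 ^ k)"

lemma cell_eq_corner: "x \<in> Q0 \<Longrightarrow> cell k x = cube n (corner k x) (l / 2 ^ k)"
  unfolding corner_def by (rule cell_eq_cube) auto

text \<open>Passing to the child with upper halves in \<open>S\<close> appends the binary digit \<open>i \<in> S\<close> to the index.\<close>

lemma child_eq_cell:
  assumes x: "x \<in> Q0" and y: "y \<in> Q0"
    and idx: "\<And>i. i < n \<Longrightarrow> idx (Suc k) y i = 2 * idx k x i + (if i \<in> S then 1 else 0)"
    and b: "\<And>i. i < n \<Longrightarrow> b i = corner k x i" and m: "m = l / 2 ^ k"
  shows "cube n (\<lambda>i. if i \<in> S then b i + m / 2 else b i) (m / 2) = cell (Suc k) y"
proof -
  have "cube n (\<lambda>i. if i \<in> S then b i + m / 2 else b i) (m / 2) = cube n (corner (Suc k) y) (l / 2 ^ Suc k)"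
  proof (subst cube_eq_iff[OF n])
    show "m / 2 = l / 2 ^ Suc k \<and>
        (\<forall>i<n. (if i \<in> S then b i + m / 2 else b i) = corner (Suc k) y i)"
    proof (intro conjI allI impI)
      show *: "m / 2 = l / 2 ^ Suc k" by (simp add: m)
      fix i assume i: "i < n"
      have "b i = a i + idx k x i * (2 * (m / 2))" using b[OF i] by (simp add: corner_def m)
      then show "(if i \<in> S then b i + m / 2 else b i) = corner (Suc k) y i"
        unfolding corner_def idx[OF i] *[symmetric] by (simp add: algebra_simps)
    qed
  qed (use l m in auto)
  then show ?thesis using cell_eq_corner[OF y] by simp
qed

text \<open>Trades the inductive definition for a description by generation and point, from which
  nesting, parents and countability are read off.\<close>

lemma dyadic_eq_cells: "dyadic n Q0 = {cell k x | k x. x \<in> Q0}"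
proof (intro equalityI subsetI)
  fix Q assume "Q \<in> dyadic n Q0"
  then show "Q \<in> {cell k x | k x. x \<in> Q0}"
  proof induction
    case root
    have "restrict a {..<n} \<in> Q0" using l by (simp add: cube_def PiE_iff)
    with cell_zero show ?case by blast
  next
    case (child b m S)
    then obtain k x where x: "x \<in> Q0" and eq: "cube n b m = cell k x" by blast
    then have bm: "m = l / 2 ^ k" "\<And>i. i < n \<Longrightarrow> b i = corner k x i"
      using child n l by (auto simp: cell_eq_corner cube_eq_iff)
    \<comment> \<open>The lower corner of the child, which represents it as a cell of the next
      generation.\<close>
    define y where "y = restrict (\<lambda>i. if i \<in> S then b i + m / 2 else b i) {..<n}"
    have "y \<in> cube n b m" using child by (auto simp: y_def cube_def PiE_iff)
    then have y: "y \<in> Q0" using eq cell_subset_root by auto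
    have "cube n (\<lambda>i. if i \<in> S then b i + m / 2 else b i) (m / 2) = cell (Suc k) y"
    proof (rule child_eq_cell[OF x y _ bm(2,1)])
      fix i assume "i < n"
      then have "y i = a i + real_of_int (2 * idx k x i + (if i \<in> S then 1 else 0)) * (l / 2 ^ Suc k)"
        by (simp add: y_def bm corner_def algebra_simps add_divide_distrib)
      with l show "idx (Suc k) y i = 2 * idx k x i + (if i \<in> S then 1 else 0)"
        by (subst idx_eq_iff) simp
    qed
    with y show ?case by blast
  qed
next
  fix Q assume "Q \<in> {cell k x | k x. x \<in> Q0}"
  then obtain k x where x: "x \<in> Q0" and Q: "Q = cell k x" by blast
  have "cell k x \<in> dyadic n Q0"
  proof (induction k)
    case 0
    then show ?case using cell_zero[OF x] by (simp add: dyadic.root)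
  next
    case (Suc k)
    \<comment> \<open>The last binary digit of the finer index tells which half of the side contains
      the coordinate of \<open>x\<close>.\<close>
    define S where "S = {i. i < n \<and> odd (idx (Suc k) x i)}"
    have "idx (Suc k) x i = 2 * idx k x i + (if i \<in> S then 1 else 0)" if "i < n" for i
    proof -
      have "idx k x i = idx (Suc k) x i div 2"
      proof -
        have "idx (Suc k) x i div 2 = \<lfloor>((x i - a i) / l * 2 ^ Suc k) / real_of_int 2\<rfloor>"
          unfolding idx_def by (rule floor_divide_real_eq_div[symmetric]) simp
        then show ?thesis by (simp add: idx_def)
      qed
      then show ?thesis using that by (simp add: S_def)
    qed
    then have "cell (Suc k) x = cube n (\<lambda>i. if i \<in> S then corner k x i + l / 2 ^ k / 2 else corner k x i) (l / 2 ^ k / 2)"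
      by (intro child_eq_cell[OF x x, symmetric]) auto
    also have "\<dots> \<in> dyadic n Q0"
      using Suc l by (intro dyadic.child) (auto simp: cell_eq_corner[OF x] S_def)
    finally show ?case .
  qed
  with Q show "Q \<in> dyadic n Q0" by simp
qed

text \<open>Both cells can be renamed after the common point \<open>z\<close>, which reduces the
  claim to \<open>cell_antimono\<close>.\<close>

lemma cell_nested:
  assumes "z \<in> cell j x" "z \<in> cell k y" "j \<le> k"
  shows "cell k y \<subseteq> cell j x"
  using cell_antimono[OF assms(3), of z] cell_cong[OF assms(1)] cell_cong[OF assms(2)] by simp

section \<open>Parents, countability and ancestors\<close>

lemma side_length_cell: "x \<in> Q0 \<Longrightarrow> side_length n (cell k x) = l / 2 ^ k"
  using n l by (simp add: cell_eq_corner side_length_cube)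

text \<open>Any candidate contains \<open>x\<close>, hence is a cell of \<open>x\<close>, and its
  side length fixes the generation.\<close>

lemma dyadic_parent_cell:
  assumes x: "x \<in> Q0"
  shows "dyadic_parent n Q0 (cell (Suc k) x) = cell k x"
  unfolding dyadic_parent_def
proof (rule the_equality)
  show "cell k x \<in> dyadic n Q0 \<and> cell (Suc k) x \<subseteq> cell k x \<and>
      side_length n (cell k x) = 2 * side_length n (cell (Suc k) x)"
    using x cell_antimono[of k "Suc k" x] by (auto simp: dyadic_eq_cells side_length_cell)
next
  fix P assume P: "P \<in> dyadic n Q0 \<and> cell (Suc k) x \<subseteq> P \<and>
      side_length n P = 2 * side_length n (cell (Suc k) x)"
  then obtain j y where y: "y \<in> Q0" "P = cell j y" by (auto simp: dyadic_eq_cells)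
  with P cell_self[OF x] have Px: "P = cell j x" by (metis cell_cong subsetD)
  have "l / 2 ^ j = l / 2 ^ k" using P x by (simp add: Px side_length_cell)
  then have "j = k" using l by simp
  with Px show "P = cell k x" by simp
qed

lemma dyadic_parent_of:
  assumes "Q \<in> dyadic n Q0 - {Q0}"
  shows "dyadic_parent n Q0 Q \<in> dyadic n Q0 \<and> Q \<subset> dyadic_parent n Q0 Q"
proof -
  obtain k x where x: "x \<in> Q0" and Q: "Q = cell k x" using assms by (auto simp: dyadic_eq_cells)
  with assms have "k \<noteq> 0" using cell_zero by auto
  then obtain j where j: "k = Suc j" by (cases k) auto
  have "cell k x \<noteq> cell j x"
    using side_length_cell[OF x, of k] side_length_cell[OF x, of j] l j by auto
  then show ?thesis
    using x cell_antimono[of j k x] by (auto simp: Q j dyadic_parent_cell dyadic_eq_cells)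
qed

lemma countable_dyadic: "countable (dyadic n Q0)"
proof -
  define h where "h = (\<lambda>(k, zs :: int list). {y \<in> Q0. \<forall>i<n. idx k y i = zs ! i})"
  have "cell k x = h (k, map (idx k x) [0..<n])" for k x
    by (auto simp: h_def cell_def)
  then have "dyadic n Q0 \<subseteq> range h" by (auto simp: dyadic_eq_cells)
  then show ?thesis by (rule countable_subset) simp
qed

text \<open>Every dyadic cube above \<open>cell k x\<close> is a cell of \<open>x\<close> of some
  generation from 0 to \<open>k\<close>.\<close>

lemma finite_dyadic_above:
  assumes "Q \<in> dyadic n Q0"
  shows "finite {P \<in> dyadic n Q0. Q \<subseteq> P}"
proof -
  obtain k x where x: "x \<in> Q0" and Q: "Q = cell k x" using assms by (auto simp: dyadic_eq_cells)
  have "{P \<in> dyadic n Q0. Q \<subseteq> P} \<subseteq> (\<lambda>j. cell j x) ` {..k}"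
  proof
    fix P assume "P \<in> {P \<in> dyadic n Q0. Q \<subseteq> P}"
    then obtain j y where P: "P = cell j y" "Q \<subseteq> P" by (auto simp: dyadic_eq_cells)
    with cell_self[OF x] Q have Px: "P = cell j x" by (metis cell_cong subsetD)
    show "P \<in> (\<lambda>j. cell j x) ` {..k}"
    proof (cases "j \<le> k")
      case False
      then have "cell j x \<subseteq> cell k x" by (intro cell_antimono) simp
      with P Px Q have "P = cell k x" by simp
      then show ?thesis by simp
    qed (use Px in auto)
  qed
  then show ?thesis by (rule finite_subset) simp
qed

end

section \<open>Dyadic differentiation\<close>

lemma avg_eq_mean: "avg n Q f = mean (leb n) Q f"
  by (simp add: avg_def mean_def)

text \<open>Extensional points are viewed as points of the full function space, a Polish space on
  which finite Borel measures are outer regular. Coordinates from \<open>n\<close> on are the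
  constant \<open>undefined\<close>.\<close>

lemma measurable_PiM_borel:
  "(\<lambda>x. x) \<in> measurable (Pi\<^sub>M {..<n} (\<lambda>_. lborel)) (borel :: (nat \<Rightarrow> real) measure)"
proof -
  have "(\<lambda>x. x) \<in> measurable (Pi\<^sub>M {..<n} (\<lambda>_. lborel)) (Pi\<^sub>M UNIV (\<lambda>_. borel :: real measure))"
  proof (rule measurable_PiM_single')
    fix i
    show "(\<lambda>x :: nat \<Rightarrow> real. x i) \<in> borel_measurable (Pi\<^sub>M {..<n} (\<lambda>_. lborel))"
    proof (cases "i < n")
      case False
      then have undef: "x i = undefined" if "x \<in> space (Pi\<^sub>M {..<n} (\<lambda>_. lborel))" for x :: "nat \<Rightarrow> real"
        using that unfolding space_PiM by (auto intro: PiE_arb)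
      have "(\<lambda>x :: nat \<Rightarrow> real. x i) \<in> borel_measurable (Pi\<^sub>M {..<n} (\<lambda>_. lborel)) \<longleftrightarrow>
          (\<lambda>_. undefined :: real) \<in> borel_measurable (Pi\<^sub>M {..<n} (\<lambda>_. lborel :: real measure))"
        by (rule measurable_cong) (rule undef)
      then show ?thesis by simp
    next
      case True
      then have "(\<lambda>x. x i) \<in> measurable (Pi\<^sub>M {..<n} (\<lambda>_. lborel)) (lborel :: real measure)"
        by (intro measurable_component_singleton) simp
      then show ?thesis unfolding measurable_cong_sets[OF refl sets_lborel] .
    qed
  qed auto
  then show ?thesis unfolding measurable_cong_sets[OF refl sets_PiM_equal_borel] .
qed

text \<open>The converse passage: the cylinder over a measurable set of extensional points is
  Borel.\<close>

lemma measurable_restrict_borel: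
  "(\<lambda>y. restrict y {..<n}) \<in> measurable (borel :: (nat \<Rightarrow> real) measure) (Pi\<^sub>M {..<n} (\<lambda>_. lborel))"
proof -
  have "(\<lambda>y. restrict y {..<n}) \<in> measurable (Pi\<^sub>M UNIV (\<lambda>_. lborel :: real measure)) (Pi\<^sub>M {..<n} (\<lambda>_. lborel))"
    by (rule measurable_restrict_subset) simp
  moreover have eq: "sets (Pi\<^sub>M UNIV (\<lambda>_::nat. lborel :: real measure)) = sets borel"
  proof -
    have "sets (Pi\<^sub>M UNIV (\<lambda>_::nat. lborel :: real measure)) = sets (Pi\<^sub>M UNIV (\<lambda>_. borel))"
      by (rule sets_PiM_cong) auto
    also have "\<dots> = sets borel" by (rule sets_PiM_equal_borel)
    finally show ?thesis .
  qed
  ultimately show ?thesis unfolding measurable_cong_sets[OF eq refl] by simp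
qed

lemma sets_leb_open:
  assumes "open (U :: (nat \<Rightarrow> real) set)"
  shows "U \<inter> extensional {..<n} \<in> sets (Pi\<^sub>M {..<n} (\<lambda>_. lborel))"
  using measurable_sets[OF measurable_PiM_borel borel_open[OF assms], of n]
  by (simp add: space_PiM PiE_def)

lemma cube_extensional: "cube n a l \<subseteq> extensional {..<n}"
  by (auto simp: cube_def PiE_def)

text \<open>Outer regularity in testing form: a lower bound \<open>c\<close> on all open sets around
  \<open>A\<close>, cut to the cube, passes to \<open>A\<close> itself.\<close>

lemma leb_outer_regular:
  assumes A: "A \<in> sets (Pi\<^sub>M {..<n} (\<lambda>_. lborel))" "A \<subseteq> cube n a l" and l: "0 \<le> l"
    and c: "\<And>U. open U \<Longrightarrow> A \<subseteq> U \<Longrightarrow> c \<le> emeasure (leb n) (U \<inter> cube n a l)"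
  shows "c \<le> emeasure (leb n) A"
proof -
  define P where "P = Pi\<^sub>M {..<n} (\<lambda>_. lborel :: real measure)"
  define Q where "Q = cube n a l"
  \<comment> \<open>Restriction to the cube makes the measure finite, and the push-forward makes it
    Borel on the full function space.\<close>
  define N where "N = distr (density P (indicator Q)) borel (\<lambda>x. x)"
  have sets_N: "sets N = sets borel" by (simp add: N_def)
  have Q: "Q \<in> sets P" by (simp add: P_def Q_def sets_cube)
  have leb_P: "emeasure (leb n) X = emeasure P X" if "X \<in> sets P" for X
    using that by (simp add: leb_def P_def)
  have N: "emeasure N X = emeasure P (Q \<inter> X)" if "X \<in> sets borel" for X
  proof -
    have X: "X \<inter> space P \<in> sets P"
      using measurable_sets[OF measurable_PiM_borel that, of n] by (simp add: P_def)
    have "emeasure N X = emeasure (density P (indicator Q)) (X \<inter> space P)"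
      unfolding N_def using measurable_PiM_borel[of n] that
      by (subst emeasure_distr) (simp_all add: P_def)
    also have "\<dots> = emeasure P (Q \<inter> (X \<inter> space P))" using Q X by (rule emeasure_restricted)
    also have "Q \<inter> (X \<inter> space P) = Q \<inter> X"
      using sets.sets_into_space[OF Q] by auto
    finally show ?thesis .
  qed
  \<comment> \<open>The cylinder over \<open>A\<close> meets the cube exactly in \<open>A\<close>,
    so its measure under \<open>N\<close> is that of \<open>A\<close>.\<close>
  define A' where "A' = (\<lambda>y. restrict y {..<n}) -` A"
  have A': "A' \<in> sets borel"
    using measurable_sets[OF measurable_restrict_borel A(1)] by (simp add: A'_def)
  have QA: "Q \<inter> A' = A"
    using A(2) cube_extensional[of n a l] unfolding A'_def Q_def by (auto simp: extensional_restrict subset_iff)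
  have "emeasure N (space N) = emeasure (leb n) Q"
    using N[of UNIV] leb_P[OF Q] sets_eq_imp_space_eq[OF sets_N] by simp
  then have "emeasure N (space N) < \<infinity>"
    by (simp add: Q_def emeasure_cube[OF l])
  then have "emeasure N A' = (INF U \<in> {U. A' \<subseteq> U \<and> open U}. emeasure N U)"
    by (intro outer_regular sets_N A') simp
  moreover have "c \<le> (INF U \<in> {U. A' \<subseteq> U \<and> open U}. emeasure N U)"
  proof (rule INF_greatest)
    fix U assume "U \<in> {U. A' \<subseteq> U \<and> open U}"
    then have U: "A' \<subseteq> U" "open U" by auto
    have "U \<inter> Q = (U \<inter> extensional {..<n}) \<inter> Q"
      using cube_extensional[of n a l] by (auto simp: Q_def)
    then have "U \<inter> Q \<in> sets P"
      using sets_leb_open[OF U(2), of n] Q by (simp add: P_def sets.Int)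
    have "c \<le> emeasure (leb n) (U \<inter> Q)"
      unfolding Q_def using U QA by (intro c) auto
    also have "\<dots> = emeasure N U"
      using \<open>U \<inter> Q \<in> sets P\<close> U by (simp add: leb_P N Int_commute)
    finally show "c \<le> emeasure N U" .
  qed
  ultimately show ?thesis
    using A(1) A' by (simp add: N QA leb_P P_def)
qed

section \<open>Domination of a function by its maximal function\<close>

context root_cube
begin

lemma dyadic_subset_root: "Q \<in> dyadic n Q0 \<Longrightarrow> Q \<subseteq> Q0"
  by (auto simp: dyadic_eq_cells cell_def)

lemma dyadic_sets: "Q \<in> dyadic n Q0 \<Longrightarrow> Q \<in> sets (leb n)"
  by (auto simp: dyadic_eq_cells cell_eq_corner leb_def sets_cube)

lemma emeasure_cell: "x \<in> Q0 \<Longrightarrow> emeasure (leb n) (cell k x) = ennreal ((l / 2 ^ k) ^ n)"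
  using l by (simp add: cell_eq_corner emeasure_cube)

sublocale nested_family "leb n" "dyadic n Q0"
proof
  fix Q assume Q: "Q \<in> dyadic n Q0"
  show "0 < emeasure (leb n) Q" "emeasure (leb n) Q < \<infinity>"
    using Q l by (auto simp: dyadic_eq_cells emeasure_cell)
next
  fix P Q assume "P \<in> dyadic n Q0" "Q \<in> dyadic n Q0" "P \<inter> Q \<noteq> {}"
  then obtain j x k y z where PQ: "P = cell j x" "Q = cell k y" and "z \<in> P" "z \<in> Q"
    unfolding dyadic_eq_cells by blast
  then have "z \<in> cell j x" "z \<in> cell k y" by simp_all
  with PQ show "P \<subseteq> Q \<or> Q \<subseteq> P"
    using cell_nested[of z j x k y] cell_nested[of z k y j x] by (cases "j \<le> k") auto
qed (use countable_dyadic dyadic_sets finite_dyadic_above in auto)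

text \<open>An open set of the product topology contains a box around \<open>x\<close>. The first
  \<open>n\<close> coordinates are handled by a small side length; the others are constant on
  \<open>Q0\<close>.\<close>

lemma small_cell:
  assumes U: "open U" "x \<in> U" and x: "x \<in> Q0"
  obtains k where "cell k x \<subseteq> U"
proof -
  obtain X where X: "x \<in> Pi\<^sub>E UNIV X" "\<And>i. open (X i)" "Pi\<^sub>E UNIV X \<subseteq> U"
    using product_topology_open_contains_basis[OF U(1)[unfolded open_fun_def] U(2)] by auto
  have "\<exists>e>0. \<forall>z. dist z (x i) < e \<longrightarrow> z \<in> X i" for i
    using X(1) X(2)[of i] by (auto simp: open_dist PiE_iff)
  then obtain e where e: "\<And>i. 0 < e i" "\<And>i z. dist z (x i) < e i \<Longrightarrow> z \<in> X i" by metis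
  define d where "d = Min (e ` {..<n})"
  have d: "0 < d" "\<And>i. i < n \<Longrightarrow> d \<le> e i"
    using e(1) n by (auto simp: d_def lessThan_empty_iff)
  obtain k where "l / d < 2 ^ k" using real_arch_pow[of 2 "l / d"] by auto
  then have k: "l / 2 ^ k < d" using d by (simp add: field_simps)
  have "cell k x \<subseteq> U"
  proof
    fix y assume y: "y \<in> cell k x"
    have "y i \<in> X i" for i
    proof (cases "i < n")
      case True
      have "y \<in> cube n (corner k x) (l / 2 ^ k)" "x \<in> cube n (corner k x) (l / 2 ^ k)"
        using y cell_self[OF x] unfolding cell_eq_corner[OF x, symmetric] by simp_all
      then have "corner k x i \<le> y i \<and> y i < corner k x i + l / 2 ^ k"
          "corner k x i \<le> x i \<and> x i < corner k x i + l / 2 ^ k"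
        using True by (auto simp: cube_def PiE_iff)
      then have "dist (y i) (x i) < l / 2 ^ k" by (simp add: dist_real_def abs_if)
      then show ?thesis using k d(2)[OF True] by (intro e(2)) simp
    next
      case False
      then have "y i = x i"
        using y x cell_subset_root[of k x] by (auto simp: cube_def PiE_def extensional_def)
      then show ?thesis using X(1) by auto
    qed
    then show "y \<in> U" using X(3) by (auto simp: PiE_iff)
  qed
  then show thesis by (rule that)
qed

lemma AE_le_maximal_fun:
  assumes f [measurable]: "f \<in> borel_measurable (leb n)"
  shows "AE x in leb n. x \<in> Q0 \<longrightarrow> f x \<le> maximal_fun f x"
proof -
  have [measurable]: "maximal_fun f \<in> borel_measurable (leb n)" by (rule measurable_maximal_fun)
  have [measurable]: "Q0 \<in> sets (leb n)" by (intro dyadic_sets dyadic.root)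
  have null: "AE x in leb n. \<not> (x \<in> Q0 \<and> maximal_fun f x < ennreal t \<and> ennreal t' < f x)"
    if "0 < t" "t < t'" for t t' :: real
  proof -
    define E where "E = {x \<in> space (leb n). x \<in> Q0 \<and> maximal_fun f x < ennreal t \<and> ennreal t' < f x}"
    have E: "E \<in> sets (leb n)" unfolding E_def by measurable
    define P where "P = Pi\<^sub>M {..<n} (\<lambda>_. lborel :: real measure)"
    have leb_P: "leb n = completion P" by (simp add: leb_def P_def)
    \<comment> \<open>\<open>E\<close> is measurable for the completion; its main part is measurable
      for the product measure, lies in \<open>E\<close> and has the same measure.\<close>
    define A where "A = main_part P E"
    have A: "A \<in> sets P" and E_A: "emeasure (leb n) E = emeasure (leb n) A"
      using E main_part_sets[of E P] by (auto simp: leb_P A_def)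
    have "A \<subseteq> E"
      using main_part_null_part_Un[of E P] E unfolding leb_P A_def by (metis Un_upper1)
    have A_leb [measurable]: "A \<in> sets (leb n)" using A by (simp add: leb_P)
    have "A \<subseteq> Q0" using \<open>A \<subseteq> E\<close> by (auto simp: E_def)
    have "ennreal (t' / t) * emeasure (leb n) A \<le> emeasure (leb n) A"
    proof (rule leb_outer_regular[where a = a and l = l and n = n])
      fix U assume U: "open U" "A \<subseteq> U"
      \<comment> \<open>Meeting \<open>A\<close> bounds the mean over each cube by \<open>t\<close>,
        and lying in \<open>U\<close> bounds the total measure of the cubes.\<close>
      define W where "W = {Q \<in> dyadic n Q0. Q \<subseteq> U \<and> Q \<inter> A \<noteq> {}}"
      have W: "W \<subseteq> dyadic n Q0" by (auto simp: W_def)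
      have AW: "A \<subseteq> \<Union>W"
      proof
        fix x assume x: "x \<in> A"
        then have "x \<in> Q0" "x \<in> U" using \<open>A \<subseteq> Q0\<close> U by auto
        then obtain k where "cell k x \<subseteq> U" using small_cell U(1) by metis
        then have "cell k x \<in> W"
          using x cell_self[OF \<open>x \<in> Q0\<close>] \<open>x \<in> Q0\<close> by (auto simp: W_def dyadic_eq_cells)
        then show "x \<in> \<Union>W" using cell_self[OF \<open>x \<in> Q0\<close>] by auto
      qed
      have WU: "\<Union>W \<subseteq> U \<inter> Q0" using W dyadic_subset_root by (auto simp: W_def)
      note W_sets [measurable] = sets_Union[OF W]
      have "ennreal t' * emeasure (leb n) A = (\<integral>\<^sup>+x\<in>A. ennreal t' \<partial>leb n)"
        by (simp add: nn_integral_cmult_indicator)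
      also have "\<dots> \<le> (\<integral>\<^sup>+x\<in>\<Union>W. f x \<partial>leb n)"
        by (rule nn_integral_mono) (use AW \<open>A \<subseteq> E\<close> in \<open>auto simp: E_def split: split_indicator\<close>)
      also have "\<dots> = emeasure (density (leb n) f) (\<Union>W)" by (simp add: emeasure_density)
      also have "\<dots> \<le> emeasure (scale_measure (ennreal t) (leb n)) (\<Union>W)"
      proof (rule compare_on_Union[OF W])
        fix Q assume "Q \<in> maximal_sets W"
        then have Q: "Q \<in> dyadic n Q0" and "Q \<inter> A \<noteq> {}" by (auto simp: maximal_sets_def W_def)
        then obtain x where x: "x \<in> Q" "x \<in> A" by auto
        have "mean (leb n) Q f \<le> maximal_fun f x"
          unfolding maximal_fun_def using Q x by (intro SUP_upper) auto
        also have "\<dots> \<le> ennreal t" using x \<open>A \<subseteq> E\<close> by (auto simp: E_def)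
        finally show "emeasure (density (leb n) f) Q \<le> emeasure (scale_measure (ennreal t) (leb n)) Q"
          using mean_le_iff[OF Q] dyadic_sets[OF Q] by (simp add: emeasure_density)
      qed auto
      also have "\<dots> \<le> ennreal t * emeasure (leb n) (U \<inter> Q0)"
      proof -
        have "U \<inter> Q0 = (U \<inter> extensional {..<n}) \<inter> Q0" using cube_extensional[of n a l] by auto
        then have "U \<inter> Q0 \<in> sets (leb n)"
          using sets_leb_open[OF U(1), of n] sets_cube by (simp add: leb_def sets.Int)
        then have "emeasure (leb n) (\<Union>W) \<le> emeasure (leb n) (U \<inter> Q0)"
          using WU by (intro emeasure_mono)
        then show ?thesis by (simp add: mult_left_mono)
      qed
      finally have "ennreal (1 / t) * (ennreal t' * emeasure (leb n) A)
          \<le> ennreal (1 / t) * (ennreal t * emeasure (leb n) (U \<inter> Q0))"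
        by (rule mult_left_mono) simp
      moreover have "ennreal (1 / t) * ennreal t' = ennreal (t' / t)" "ennreal (1 / t) * ennreal t = 1"
        using that by (simp_all flip: ennreal_mult)
      ultimately show "ennreal (t' / t) * emeasure (leb n) A \<le> emeasure (leb n) (U \<inter> Q0)"
        by (simp add: mult.assoc[symmetric])
    qed (use A \<open>A \<subseteq> Q0\<close> l in \<open>auto simp: P_def\<close>)
    \<comment> \<open>For a finite measure the factor \<open>t' / t > 1\<close> forces the value
      0.\<close>
    moreover have "emeasure (leb n) A < \<infinity>"
      using emeasure_mono[OF \<open>A \<subseteq> Q0\<close>, of "leb n"] fin[OF dyadic.root]
      by (auto intro: le_less_trans)
    then obtain m where m: "0 \<le> m" "emeasure (leb n) A = ennreal m"
      by (cases "emeasure (leb n) A") auto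
    ultimately have "t' / t * m \<le> m"
      using that by (simp add: ennreal_mult[symmetric])
    then have "m \<le> 0"
      using that mult_strict_left_mono[of t t' m] by (cases "0 < m") (auto simp: field_simps)
    with m have "emeasure (leb n) E = 0" by (simp add: E_A)
    with E have "E \<in> null_sets (leb n)" by (intro null_setsI)
    then show ?thesis
      by (rule AE_I') (auto simp: E_def)
  qed
  \<comment> \<open>Rational pairs keep the exceptional set a countable union of null sets.\<close>
  have "AE x in leb n. \<forall>q r :: rat. 0 < real_of_rat q \<and> real_of_rat q < real_of_rat r \<longrightarrow>
     \<not> (x \<in> Q0 \<and> maximal_fun f x < ennreal (real_of_rat q) \<and> ennreal (real_of_rat r) < f x)"
    unfolding AE_all_countable by (intro allI AE_impI null) auto
  then show ?thesis
  proof eventually_elim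
    case (elim x)
    show ?case
    proof (intro impI, rule ccontr)
      assume x: "x \<in> Q0" "\<not> f x \<le> maximal_fun f x"
      then have "maximal_fun f x < f x" by simp
      then obtain q where q: "maximal_fun f x < ennreal (real_of_rat q)" "ennreal (real_of_rat q) < f x"
        using ennreal_rat_dense[of "maximal_fun f x" "f x"] by auto
      then obtain r where r: "ennreal (real_of_rat q) < ennreal (real_of_rat r)" "ennreal (real_of_rat r) < f x"
        using ennreal_rat_dense[of "ennreal (real_of_rat q)" "f x"] by auto
      have "0 < real_of_rat q"
        using q(1) by (cases "0 < (real_of_rat q :: real)") (auto simp: ennreal_neg)
      moreover have "real_of_rat q < real_of_rat r"
        using r(1) ennreal_leI[of "real_of_rat r" "real_of_rat q"] by (auto simp: not_less[symmetric])
      ultimately show False using elim x q(1) r(2) by auto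
    qed
  qed
qed

end

section \<open>The decomposition hypothesis\<close>

context root_cube
begin

text \<open>Normalised norms over \<open>Q0\<close> are ordinary norms for this probability
  measure.\<close>

abbreviation U :: "(nat \<Rightarrow> real) measure" where
  "U \<equiv> uniform_measure (leb n) Q0"

lemma root_sets [measurable]: "Q0 \<in> sets (leb n)"
  by (intro dyadic_sets dyadic.root)

lemma emeasure_root: "emeasure (leb n) Q0 \<noteq> 0" "emeasure (leb n) Q0 \<noteq> \<infinity>"
  using pos[OF dyadic.root] fin[OF dyadic.root] by auto

lemma emeasure_U:
  assumes "{x \<in> space (leb n). P x} \<in> sets (leb n)"
  shows "emeasure U {x \<in> space U. P x} = emeasure (leb n) {x \<in> Q0. P x} / emeasure (leb n) Q0"
proof -
  have "Q0 \<inter> {x \<in> space (leb n). P x} = {x \<in> Q0. P x}"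
    using sets.sets_into_space[OF root_sets] by auto
  then show ?thesis using assms by simp
qed

lemma emeasure_space_U: "emeasure U (space U) \<le> 1"
  using emeasure_root emeasure_U[of "\<lambda>_. True"] by (simp add: ennreal_divide_self less_top)

lemma weak_Lp_norm_U:
  assumes [measurable]: "f \<in> borel_measurable (leb n)"
  shows "weak_Lp_norm n p Q0 f =
    (SUP t\<in>{0<..}. ennreal t * epowr (emeasure U {x \<in> space U. ennreal t < f x}) (1 / p))"
  unfolding weak_Lp_norm_def by (subst emeasure_U) simp_all

lemma Lp_norm_U:
  assumes [measurable]: "f \<in> borel_measurable (leb n)"
  shows "Lp_norm n p Q0 f = epowr (\<integral>\<^sup>+x. epowr (f x) p \<partial>U) (1 / p)"
  unfolding Lp_norm_def avg_def by (subst nn_integral_uniform_measure) simp_all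

end

locale decomposed_cube = root_cube n a l for n a l +
  fixes \<Theta> \<delta> :: real and F :: "(nat \<Rightarrow> real) \<Rightarrow> real"
    and H G :: "(nat \<Rightarrow> real) set \<Rightarrow> (nat \<Rightarrow> real) \<Rightarrow> ennreal" and g :: "(nat \<Rightarrow> real) set \<Rightarrow> real"
  assumes dec: "decomposition n Q0 \<Theta> \<delta> F H G g" and \<Theta>: "1 \<le> \<Theta>" and \<delta>: "0 \<le> \<delta>"
begin

text \<open>The cut-off is measurable on the whole space, since integrability on \<open>Q0\<close>
  concerns the product with the indicator. Negative values of \<open>F\<close>, which occur on a
  null subset of \<open>Q0\<close>, become 0.\<close>

definition F0 :: "(nat \<Rightarrow> real) \<Rightarrow> ennreal" where
  "F0 x = ennreal (indicator Q0 x * F x)"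

abbreviation "MF \<equiv> dyadic_maximal n Q0 F"
abbreviation "G_star \<equiv> g_star n Q0 g"

lemma integrable_F: "integrable (leb n) (\<lambda>x. indicator Q0 x * F x)"
  using dec by (simp add: decomposition_def set_integrable_def)

lemma measurable_F0 [measurable]: "F0 \<in> borel_measurable (leb n)"
  unfolding F0_def using borel_measurable_integrable[OF integrable_F] by measurable

lemma AE_F0: "AE x in leb n. x \<in> Q0 \<longrightarrow> F0 x = ennreal (F x) \<and> F0 x = ennreal \<bar>F x\<bar>"
proof -
  have "AE x in leb n. x \<in> Q0 \<longrightarrow> 0 \<le> F x" using dec by (simp add: decomposition_def)
  then show ?thesis by eventually_elim (auto simp: F0_def)
qed

lemma avg_F:
  assumes "Q \<in> dyadic n Q0"
  shows "avg n Q (\<lambda>x. ennreal (F x)) = mean (leb n) Q F0"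
    and "avg n Q (\<lambda>x. ennreal \<bar>F x\<bar>) = mean (leb n) Q F0"
proof -
  have sub: "Q \<subseteq> Q0" using assms by (rule dyadic_subset_root)
  have "(\<integral>\<^sup>+x\<in>Q. ennreal (F x) \<partial>leb n) = (\<integral>\<^sup>+x\<in>Q. F0 x \<partial>leb n)"
    using AE_F0 by (intro nn_integral_cong_AE, eventually_elim) (use sub in \<open>auto split: split_indicator\<close>)
  then show "avg n Q (\<lambda>x. ennreal (F x)) = mean (leb n) Q F0" by (simp add: avg_def mean_def)
  have "(\<integral>\<^sup>+x\<in>Q. ennreal \<bar>F x\<bar> \<partial>leb n) = (\<integral>\<^sup>+x\<in>Q. F0 x \<partial>leb n)"
    using AE_F0 by (intro nn_integral_cong_AE, eventually_elim) (use sub in \<open>auto split: split_indicator\<close>)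
  then show "avg n Q (\<lambda>x. ennreal \<bar>F x\<bar>) = mean (leb n) Q F0" by (simp add: avg_def mean_def)
qed

lemma MF_eq: "MF = maximal_fun F0"
  by (rule ext) (simp add: dyadic_maximal_def maximal_fun_def avg_F cong: SUP_cong_simp)

lemma measurable_MF [measurable]: "MF \<in> borel_measurable (leb n)"
  unfolding MF_eq by (rule measurable_maximal_fun)

lemma measurable_G_star [measurable]: "G_star \<in> borel_measurable (leb n)"
  unfolding g_star_def[abs_def] by (rule measurable_SUP_family) auto

lemma root_average_finite: "avg n Q0 (\<lambda>x. ennreal (F x)) < \<infinity>"
proof -
  have "(\<integral>\<^sup>+x\<in>Q0. F0 x \<partial>leb n) \<le> (\<integral>\<^sup>+x. ennreal (norm (indicator Q0 x * F x)) \<partial>leb n)"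
    by (intro nn_integral_mono) (auto simp: F0_def split: split_indicator intro!: ennreal_leI)
  also have "\<dots> < \<infinity>" using integrable_F by (simp add: integrable_iff_bounded)
  finally show ?thesis
    using emeasure_root unfolding avg_F(1)[OF dyadic.root] mean_def infinity_ennreal_def less_top[symmetric]
    by (simp add: ennreal_divide_eq_top_iff)
qed

text \<open>The essential supremum of \<open>H Q\<close> bounds it almost everywhere on
  \<open>Q\<close>, which yields the hypothesis \<open>split\<close> of
  \<open>good_lambda\<close>.\<close>

lemma local_good_lambda:
  assumes "avg n Q0 (\<lambda>x. ennreal (F x)) \<le> ennreal s" "0 < s" "\<Theta> < K" "0 < \<gamma>"
  shows "emeasure (leb n) {x \<in> Q0. ennreal (K * s) < MF x \<and> G_star x \<le> ennreal (\<gamma> * s)}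
    \<le> ennreal ((\<delta> + \<gamma>) / (K - \<Theta>)) * emeasure (leb n) {x \<in> Q0. ennreal s < MF x}"
proof -
  have *: "H Q \<in> borel_measurable (restrict_space (leb n) Q)"
      "G Q \<in> borel_measurable (restrict_space (leb n) Q)"
      "AE x in leb n. x \<in> Q \<longrightarrow> ennreal (F x) \<le> G Q x + H Q x"
      "esssup (restrict_space (leb n) Q) (H Q)
        \<le> ennreal \<Theta> * avg n (dyadic_parent n Q0 Q) (\<lambda>x. ennreal (F x))"
      "avg n Q (G Q)
        \<le> ennreal \<delta> * avg n (dyadic_parent n Q0 Q) (\<lambda>x. ennreal (F x)) + ennreal (g Q)"
    if "Q \<in> dyadic n Q0 - {Q0}" for Q
    using dec that unfolding decomposition_def by blast+
  have "emeasure (leb n) ({x. ennreal (K * s) < maximal_fun F0 x \<and>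
      (SUP Q \<in> {Q \<in> dyadic n Q0 - {Q0}. x \<in> Q}. ennreal (g Q)) \<le> ennreal (\<gamma> * s)} \<inter> Q0)
    \<le> ennreal ((\<delta> + \<gamma>) / (K - \<Theta>)) * emeasure (leb n) {x \<in> Q0. ennreal s < maximal_fun F0 x}"
  proof (rule good_lambda[where par = "dyadic_parent n Q0" and G = G])
    fix Q assume Q: "Q \<in> dyadic n Q0 - {Q0}"
    then have QD: "Q \<in> dyadic n Q0" by simp
    have QM: "Q \<inter> space (leb n) \<in> sets (leb n)" using dyadic_sets[OF QD] by simp
    have par: "dyadic_parent n Q0 Q \<in> dyadic n Q0" using dyadic_parent_of[OF Q] by simp
    show "dyadic_parent n Q0 Q \<in> dyadic n Q0 \<and> Q \<subset> dyadic_parent n Q0 Q"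
      by (rule dyadic_parent_of[OF Q])
    show "(\<lambda>x. G Q x * indicator Q x) \<in> borel_measurable (leb n)"
      using *(2)[OF Q] by (simp add: borel_measurable_restrict_space_iff_ennreal[OF QM])
    have "AE x in restrict_space (leb n) Q. H Q x \<le> esssup (restrict_space (leb n) Q) (H Q)"
      by (rule esssup_AE)
    then have "AE x in leb n. x \<in> Q \<longrightarrow> H Q x \<le> esssup (restrict_space (leb n) Q) (H Q)"
      by (simp add: AE_restrict_space_iff[OF QM])
    then show "AE x in leb n. x \<in> Q \<longrightarrow>
        F0 x \<le> G Q x + ennreal \<Theta> * mean (leb n) (dyadic_parent n Q0 Q) F0"
      using *(3)[OF Q] AE_F0
    proof eventually_elim
      case (elim x)
      show ?case
      proof
        assume x: "x \<in> Q"
        then have "F0 x \<le> G Q x + H Q x"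
          using elim dyadic_subset_root[OF QD] by auto
        also have "H Q x \<le> ennreal \<Theta> * mean (leb n) (dyadic_parent n Q0 Q) F0"
          using elim x *(4)[OF Q] by (simp add: avg_F(1)[OF par])
        finally show "F0 x \<le> G Q x + ennreal \<Theta> * mean (leb n) (dyadic_parent n Q0 Q) F0"
          by (simp add: add_left_mono)
      qed
    qed
    show "mean (leb n) Q (G Q)
        \<le> ennreal \<delta> * mean (leb n) (dyadic_parent n Q0 Q) F0 + ennreal (g Q)"
      using *(5)[OF Q] unfolding avg_F(1)[OF par] unfolding avg_eq_mean .
  next
    show "mean (leb n) Q0 F0 \<le> ennreal s" using assms by (simp add: avg_F(1)[OF dyadic.root])
  qed (use assms \<Theta> \<delta> dyadic_subset_root in \<open>auto intro: dyadic.root\<close>)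
  then show ?thesis
    unfolding MF_eq g_star_def by (simp add: Int_def conj_commute conj_left_commute)
qed

text \<open>The level set is divided according to whether \<open>G_star\<close> exceeds
  \<open>\<gamma> * s\<close>; the measures are then normalised.\<close>

lemma good_lambda_U:
  assumes "avg n Q0 (\<lambda>x. ennreal (F x)) \<le> ennreal s" "0 < s" "\<Theta> < K" "0 < \<gamma>"
  shows "emeasure U {x \<in> space U. ennreal (K * s) < MF x}
    \<le> ennreal ((\<delta> + \<gamma>) / (K - \<Theta>)) * emeasure U {x \<in> space U. ennreal s < MF x}
      + emeasure U {x \<in> space U. ennreal (\<gamma> * s) < G_star x}"
proof -
  have meas: "{x \<in> space (leb n). P x} \<in> sets (leb n) \<Longrightarrow> {x \<in> Q0. P x} \<in> sets (leb n)" for P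
  proof -
    assume "{x \<in> space (leb n). P x} \<in> sets (leb n)"
    then have "Q0 \<inter> {x \<in> space (leb n). P x} \<in> sets (leb n)" by simp
    also have "Q0 \<inter> {x \<in> space (leb n). P x} = {x \<in> Q0. P x}"
      using sets.sets_into_space[OF root_sets] by auto
    finally show ?thesis .
  qed
  have "emeasure (leb n) {x \<in> Q0. ennreal (K * s) < MF x}
    \<le> emeasure (leb n) ({x \<in> Q0. ennreal (K * s) < MF x \<and> G_star x \<le> ennreal (\<gamma> * s)}
        \<union> {x \<in> Q0. ennreal (\<gamma> * s) < G_star x})"
    by (intro emeasure_mono sets.Un meas) auto
  also have "\<dots> \<le> emeasure (leb n) {x \<in> Q0. ennreal (K * s) < MF x \<and> G_star x \<le> ennreal (\<gamma> * s)}
      + emeasure (leb n) {x \<in> Q0. ennreal (\<gamma> * s) < G_star x}"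
    by (intro emeasure_subadditive meas) auto
  also have "\<dots> \<le> ennreal ((\<delta> + \<gamma>) / (K - \<Theta>)) * emeasure (leb n) {x \<in> Q0. ennreal s < MF x}
      + emeasure (leb n) {x \<in> Q0. ennreal (\<gamma> * s) < G_star x}"
    by (intro add_right_mono local_good_lambda assms)
  finally have "emeasure (leb n) {x \<in> Q0. ennreal (K * s) < MF x} / emeasure (leb n) Q0
    \<le> (ennreal ((\<delta> + \<gamma>) / (K - \<Theta>)) * emeasure (leb n) {x \<in> Q0. ennreal s < MF x}
      + emeasure (leb n) {x \<in> Q0. ennreal (\<gamma> * s) < G_star x}) / emeasure (leb n) Q0"
    by (rule divide_right_mono_ennreal)
  then show ?thesis
    by (subst (1 2 3) emeasure_U) (simp_all add: add_divide_distrib_ennreal ennreal_times_divide)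
qed

section \<open>Norm inequalities on the root cube\<close>

lemma norm_F_le_norm_MF:
  assumes "0 < p"
  shows "weak_Lp_norm n p Q0 (\<lambda>x. ennreal \<bar>F x\<bar>) \<le> weak_Lp_norm n p Q0 MF"
    and "Lp_norm n p Q0 (\<lambda>x. ennreal \<bar>F x\<bar>) \<le> Lp_norm n p Q0 MF"
proof -
  have AE: "AE x in leb n. x \<in> Q0 \<longrightarrow> ennreal \<bar>F x\<bar> \<le> MF x"
    using AE_F0 AE_le_maximal_fun[OF measurable_F0] unfolding MF_eq by eventually_elim auto
  show "weak_Lp_norm n p Q0 (\<lambda>x. ennreal \<bar>F x\<bar>) \<le> weak_Lp_norm n p Q0 MF"
    unfolding weak_Lp_norm_def
  proof (intro SUP_mono' mult_left_mono epowr_mono divide_right_mono_ennreal)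
    fix t :: real
    have "Q0 \<inter> {x \<in> space (leb n). ennreal t < MF x} \<in> sets (leb n)" by measurable
    also have "Q0 \<inter> {x \<in> space (leb n). ennreal t < MF x} = {x \<in> Q0. ennreal t < MF x}"
      using sets.sets_into_space[OF root_sets] by auto
    finally show "emeasure (leb n) {x \<in> Q0. ennreal t < ennreal \<bar>F x\<bar>}
        \<le> emeasure (leb n) {x \<in> Q0. ennreal t < MF x}"
      using AE by (intro emeasure_mono_AE) (auto elim!: eventually_mono intro: less_le_trans)
  qed (use assms in auto)
  show "Lp_norm n p Q0 (\<lambda>x. ennreal \<bar>F x\<bar>) \<le> Lp_norm n p Q0 MF"
    unfolding Lp_norm_def avg_def
  proof (intro epowr_mono divide_right_mono_ennreal nn_integral_mono_AE)
    show "AE x in leb n. epowr (ennreal \<bar>F x\<bar>) p * indicator Q0 x \<le> epowr (MF x) p * indicator Q0 x"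
      using AE by eventually_elim (use assms in \<open>auto intro: epowr_mono split: split_indicator\<close>)
  qed (use assms in auto)
qed

text \<open>With \<open>K = 2 * \<Theta>\<close> the denominator \<open>K - \<Theta>\<close> is
  \<open>\<Theta>\<close>, whence the coefficient \<open>(\<delta> + \<gamma>) / \<Theta>\<close>;
  \<open>small\<close> is then the contraction condition.\<close>

lemma norm_MF_bounds:
  fixes p \<gamma> :: real
  assumes p: "1 < p" and \<gamma>: "0 < \<gamma>" and small: "(2 * \<Theta>) powr p * ((\<delta> + \<gamma>) / \<Theta>) < 1"
  defines "C \<equiv> norm_const (2 * \<Theta>) ((\<delta> + \<gamma>) / \<Theta>) \<gamma> p"
  shows "weak_Lp_norm n p Q0 MF
      \<le> ennreal C * weak_Lp_norm n p Q0 G_star + ennreal C * avg n Q0 (\<lambda>x. ennreal (F x))"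
    and "Lp_norm n p Q0 MF
      \<le> ennreal C * Lp_norm n p Q0 G_star + ennreal C * avg n Q0 (\<lambda>x. ennreal (F x))"
proof -
  have C: "0 < C" unfolding C_def using small by (rule norm_const_pos)
  obtain v where v: "0 \<le> v" "avg n Q0 (\<lambda>x. ennreal (F x)) = ennreal v"
    using root_average_finite by (cases "avg n Q0 (\<lambda>x. ennreal (F x))") auto
  \<comment> \<open>The starting level must be positive while the average \<open>v\<close> may be 0.
    The bound is therefore taken at \<open>s = v + e / C\<close>, where the excess contributes
    exactly \<open>e\<close>.\<close>
  have limit: "X \<le> ennreal C * Y + ennreal C * ennreal v"
    if "\<And>s. 0 < s \<Longrightarrow> v \<le> s \<Longrightarrow> X \<le> ennreal C * (ennreal s + Y)" for X Y
  proof (rule ennreal_le_epsilon)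
    fix e :: real assume e: "0 < e"
    have "X \<le> ennreal C * (ennreal (v + e / C) + Y)"
      using e C v by (intro that) (auto intro: add_nonneg_pos)
    also have "ennreal C * (ennreal (v + e / C) + Y) = ennreal C * Y + ennreal (C * (v + e / C))"
      using C e v by (subst ennreal_mult) (auto simp: distrib_left add.commute)
    also have "C * (v + e / C) = C * v + e" using C by (simp add: field_simps)
    also have "ennreal (C * v + e) = ennreal C * ennreal v + ennreal e"
      using C v e by (simp add: ennreal_mult)
    finally show "X \<le> ennreal C * Y + ennreal C * ennreal v + ennreal e" by (simp add: add.assoc)
  qed
  have meas [measurable]: "MF \<in> borel_measurable U" "G_star \<in> borel_measurable U"
    by (simp_all add: measurable_cong_sets[OF sets_uniform_measure refl])
  have const: "2 \<le> 2 * \<Theta>" "0 \<le> (\<delta> + \<gamma>) / \<Theta>" "1 \<le> p" using \<Theta> \<delta> \<gamma> p by auto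
  have good: "emeasure U {x \<in> space U. ennreal (2 * \<Theta> * s) < MF x}
      \<le> ennreal ((\<delta> + \<gamma>) / \<Theta>) * emeasure U {x \<in> space U. ennreal s < MF x}
        + emeasure U {x \<in> space U. ennreal (\<gamma> * s) < G_star x}"
    if "0 < s0" "v \<le> s0" "s0 \<le> s" for s s0
    using good_lambda_U[of s "2 * \<Theta>" \<gamma>] that v \<gamma> \<Theta> by (simp add: ennreal_leI)
  have "weak_Lp_norm n p Q0 MF \<le> ennreal C * (ennreal s + weak_Lp_norm n p Q0 G_star)"
    if "0 < s" "v \<le> s" for s
    using good_lambda_weak_norm[OF meas emeasure_space_U const(1,2) \<gamma> const(3) small that(1) good[OF that]]
    unfolding C_def by (simp only: weak_Lp_norm_U measurable_MF measurable_G_star)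
  from limit[OF this] show "weak_Lp_norm n p Q0 MF
      \<le> ennreal C * weak_Lp_norm n p Q0 G_star + ennreal C * avg n Q0 (\<lambda>x. ennreal (F x))"
    by (simp only: v)
  have "Lp_norm n p Q0 MF \<le> ennreal C * (ennreal s + Lp_norm n p Q0 G_star)"
    if "0 < s" "v \<le> s" for s
    using good_lambda_strong_norm[OF meas emeasure_space_U const(1,2) \<gamma> const(3) small that(1) good[OF that]]
    unfolding C_def by (simp only: Lp_norm_U measurable_MF measurable_G_star)
  from limit[OF this] show "Lp_norm n p Q0 MF
      \<le> ennreal C * Lp_norm n p Q0 G_star + ennreal C * avg n Q0 (\<lambda>x. ennreal (F x))"
    by (simp only: v)
qed

end

section \<open>Choice of parameters and conclusion\<close>

lemma decomposition_cube:
  assumes "decomposition n Q0 \<Theta> \<delta> F H G g" "1 \<le> \<Theta>" "0 \<le> \<delta>"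
  obtains a l where "Q0 = cube n a l" "decomposed_cube n a l \<Theta> \<delta> F H G g"
proof -
  obtain a l where "0 < l" "Q0 = cube n a l" "1 \<le> n"
    using assms(1) by (auto simp: decomposition_def is_cube_def)
  then show thesis using assms
    by (intro that[of a l]) (auto simp: decomposed_cube_def decomposed_cube_axioms_def root_cube_def)
qed

text \<open>For \<open>\<delta> > 0\<close> the bound on \<open>p\<close> says
  \<open>2 * \<delta> * (2 * \<Theta>) powr (p - 1) < 1\<close>, a strict inequality that leaves
  room for \<open>\<gamma>\<close>.\<close>

lemma exponent_condition:
  fixes \<Theta> \<delta> p :: real
  assumes "1 \<le> \<Theta>" "0 \<le> \<delta>" "\<delta> = 0 \<or> p < 1 + ln (1 / (2 * \<delta>)) / ln (2 * \<Theta>)"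
  obtains \<gamma> where "0 < \<gamma>" "(2 * \<Theta>) powr p * ((\<delta> + \<gamma>) / \<Theta>) < 1"
proof -
  define r where "r = (2 * \<Theta>) powr p"
  have r: "0 < r" using assms by (simp add: r_def)
  have "r * \<delta> < \<Theta>"
  proof (cases "\<delta> = 0")
    case False
    with assms have \<delta>: "0 < \<delta>" by simp
    have ln: "0 < ln (2 * \<Theta>)" using assms by simp
    have "(p - 1) * ln (2 * \<Theta>) < ln (1 / (2 * \<delta>))"
      using assms(3) False ln by (simp add: field_simps)
    then have "exp ((p - 1) * ln (2 * \<Theta>)) < exp (ln (1 / (2 * \<delta>)))" by simp
    then have "(2 * \<Theta>) powr (p - 1) < 1 / (2 * \<delta>)"
      using assms \<delta> by (simp add: powr_def)
    then have "\<Theta> * (2 * \<delta> * (2 * \<Theta>) powr (p - 1)) < \<Theta> * 1"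
      using assms \<delta> by (intro mult_strict_left_mono) (auto simp: field_simps)
    moreover have "r = 2 * \<Theta> * (2 * \<Theta>) powr (p - 1)"
      using assms by (simp add: r_def powr_diff)
    ultimately show ?thesis by (simp add: mult_ac)
  qed (use assms in simp)
  \<comment> \<open>This choice of \<open>\<gamma>\<close> uses half of the slack:
    \<open>r * (\<delta> + \<gamma>)\<close> is the midpoint of \<open>r * \<delta>\<close> and
    \<open>\<Theta>\<close>.\<close>
  then have "r * ((\<delta> + (\<Theta> - r * \<delta>) / (2 * r)) / \<Theta>) < 1" "0 < (\<Theta> - r * \<delta>) / (2 * r)"
    using r assms by (simp_all add: field_simps)
  then show thesis using that unfolding r_def by blast
qed

text \<open>\<open>C\<close> is quantified before the dimension, the cube and the functions, which
  expresses its dependence on \<open>p\<close>, \<open>\<Theta>\<close> and \<open>\<delta>\<close>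
  alone.\<close>

theorem theorem2p1:
  fixes \<Theta> \<delta> :: real
  assumes "1 \<le> \<Theta>" and "0 \<le> \<delta>" and "\<delta> < 1 / 2"
  shows "(\<forall>n Q0 F H G g. decomposition n Q0 \<Theta> \<delta> F H G g \<longrightarrow>
      (\<forall>s K \<gamma> :: real.
        avg n Q0 (\<lambda>x. ennreal (F x)) \<le> ennreal s \<and> 0 < s \<and> \<Theta> < K \<and> 0 < \<gamma> \<and> \<gamma> < 1 \<longrightarrow>
        emeasure (leb n) {x \<in> Q0. ennreal (K * s) < dyadic_maximal n Q0 F x \<and>
            g_star n Q0 g x \<le> ennreal (\<gamma> * s)}
          \<le> ennreal ((\<delta> + \<gamma>) / (K - \<Theta>)) *
            emeasure (leb n) {x \<in> Q0. ennreal s < dyadic_maximal n Q0 F x}))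
    \<and>
    (\<forall>p :: real. 1 < p \<and> (\<delta> = 0 \<or> p < 1 + ln (1 / (2 * \<delta>)) / ln (2 * \<Theta>)) \<longrightarrow>
      (\<exists>C :: real. 0 < C \<and>
        (\<forall>n Q0 F H G g. decomposition n Q0 \<Theta> \<delta> F H G g \<longrightarrow>
          weak_Lp_norm n p Q0 (\<lambda>x. ennreal \<bar>F x\<bar>) \<le> weak_Lp_norm n p Q0 (dyadic_maximal n Q0 F) \<and>
          weak_Lp_norm n p Q0 (dyadic_maximal n Q0 F)
            \<le> ennreal C * weak_Lp_norm n p Q0 (g_star n Q0 g)
              + ennreal C * avg n Q0 (\<lambda>x. ennreal (F x)) \<and>
          Lp_norm n p Q0 (\<lambda>x. ennreal \<bar>F x\<bar>) \<le> Lp_norm n p Q0 (dyadic_maximal n Q0 F) \<and>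
          Lp_norm n p Q0 (dyadic_maximal n Q0 F)
            \<le> ennreal C * Lp_norm n p Q0 (g_star n Q0 g)
              + ennreal C * avg n Q0 (\<lambda>x. ennreal (F x)))))"
proof (intro conjI allI impI)
  fix n Q0 F H G g and s K \<gamma> :: real
  assume "decomposition n Q0 \<Theta> \<delta> F H G g"
  then obtain a l where Q0: "Q0 = cube n a l" and "decomposed_cube n a l \<Theta> \<delta> F H G g"
    using assms(1,2) by (rule decomposition_cube)
  then interpret decomposed_cube n a l \<Theta> \<delta> F H G g by simp
  assume "avg n Q0 (\<lambda>x. ennreal (F x)) \<le> ennreal s \<and> 0 < s \<and> \<Theta> < K \<and> 0 < \<gamma> \<and> \<gamma> < 1"
  then show "emeasure (leb n) {x \<in> Q0. ennreal (K * s) < dyadic_maximal n Q0 F x \<and>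
            g_star n Q0 g x \<le> ennreal (\<gamma> * s)}
          \<le> ennreal ((\<delta> + \<gamma>) / (K - \<Theta>)) *
            emeasure (leb n) {x \<in> Q0. ennreal s < dyadic_maximal n Q0 F x}"
    unfolding Q0 by (intro local_good_lambda) auto
next
  fix p :: real
  assume p: "1 < p \<and> (\<delta> = 0 \<or> p < 1 + ln (1 / (2 * \<delta>)) / ln (2 * \<Theta>))"
  obtain \<gamma> where \<gamma>: "0 < \<gamma>" "(2 * \<Theta>) powr p * ((\<delta> + \<gamma>) / \<Theta>) < 1"
    using exponent_condition[OF assms(1,2)] p by blast
  define C where "C = norm_const (2 * \<Theta>) ((\<delta> + \<gamma>) / \<Theta>) \<gamma> p"
  have "weak_Lp_norm n p Q0 (\<lambda>x. ennreal \<bar>F x\<bar>) \<le> weak_Lp_norm n p Q0 (dyadic_maximal n Q0 F) \<and>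
      weak_Lp_norm n p Q0 (dyadic_maximal n Q0 F)
        \<le> ennreal C * weak_Lp_norm n p Q0 (g_star n Q0 g) + ennreal C * avg n Q0 (\<lambda>x. ennreal (F x)) \<and>
      Lp_norm n p Q0 (\<lambda>x. ennreal \<bar>F x\<bar>) \<le> Lp_norm n p Q0 (dyadic_maximal n Q0 F) \<and>
      Lp_norm n p Q0 (dyadic_maximal n Q0 F)
        \<le> ennreal C * Lp_norm n p Q0 (g_star n Q0 g) + ennreal C * avg n Q0 (\<lambda>x. ennreal (F x))"
    if d: "decomposition n Q0 \<Theta> \<delta> F H G g" for n Q0 F H G g
  proof -
    obtain a l where Q0: "Q0 = cube n a l" and "decomposed_cube n a l \<Theta> \<delta> F H G g"
      using d assms(1,2) by (rule decomposition_cube)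
    then interpret decomposed_cube n a l \<Theta> \<delta> F H G g by simp
    show ?thesis
      unfolding Q0 C_def using norm_F_le_norm_MF[of p] norm_MF_bounds[of p \<gamma>] p \<gamma> by auto
  qed
  moreover have "0 < C" unfolding C_def using \<gamma>(2) by (rule norm_const_pos)
  ultimately show "\<exists>C :: real. 0 < C \<and>
        (\<forall>n Q0 F H G g. decomposition n Q0 \<Theta> \<delta> F H G g \<longrightarrow>
          weak_Lp_norm n p Q0 (\<lambda>x. ennreal \<bar>F x\<bar>) \<le> weak_Lp_norm n p Q0 (dyadic_maximal n Q0 F) \<and>
          weak_Lp_norm n p Q0 (dyadic_maximal n Q0 F)
            \<le> ennreal C * weak_Lp_norm n p Q0 (g_star n Q0 g)
              + ennreal C * avg n Q0 (\<lambda>x. ennreal (F x)) \<and>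
          Lp_norm n p Q0 (\<lambda>x. ennreal \<bar>F x\<bar>) \<le> Lp_norm n p Q0 (dyadic_maximal n Q0 F) \<and>
          Lp_norm n p Q0 (dyadic_maximal n Q0 F)
            \<le> ennreal C * Lp_norm n p Q0 (g_star n Q0 g)
              + ennreal C * avg n Q0 (\<lambda>x. ennreal (F x)))"
    by blast
qed

end
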